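(* Let $G$ be a countable amenable group, let $d\in\mathbb N$, let $G^d$ denote the $d$-th cartesian power of $G$, and let $E\subset G^d$. For $g=(g_1,\dots,g_d),\ h=(h_1,\dots,h_d)\in G^d$, let $$h.g:=\{(h_1^{-\varepsilon_1}g_1,\dots,h_d^{-\varepsilon_d}g_d):\varepsilon\in\{0,1\}^d\}.$$ If $\Psi$ is a left Følner sequence in $G^d$ with $d_\Psi(E)>0$, then for all $c>0$ the set $$\left\{h\in G^d:\ d_\Psi(\{g\in G^d: h.g\subset E\})>d_\Psi(E)^{2^d}-c\right\}$$ is both left- and right-syndetic in $G^d$.
   Context: For a countable discrete group $H$, a left Følner sequence in $H$ is a sequence $\Psi=\{\Psi_N\}_{N\in\mathbb N}$ of finite nonempty subsets of $H$ with $\lim_{N\to\infty}|\Psi_N\cap g\Psi_N|/|\Psi_N|=1$ for all $g\in H$; $H$ is amenable if it has a Følner sequence. For a left Følner sequence $\Psi$ in $H$ and $A\subset H$, the upper density of $A$ with respect to $\Psi$ is $d_\Psi(A)=\limsup_{N\to\infty}|A\cap\Psi_N|/|\Psi_N|$. A subset $S\subset H$ is left-syndetic (resp. right-syndetic) if there exist finitely many $g_1,\dots,g_k\in H$ such that $H=\bigcup_{i=1}^k g_iS$ (resp. $H=\bigcup_{i=1}^k Sg_i$). *)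

theory Defs
  imports
    "HOL-Algebra.Product_Groups"
    "HOL-Library.Extended_Real"
    "HOL-Library.Countable_Set"
begin

definition left_Folner_seq :: "('a, 'm) monoid_scheme \<Rightarrow> (nat \<Rightarrow> 'a set) \<Rightarrow> bool" where
  "left_Folner_seq H \<Psi> \<longleftrightarrow>
     (\<forall>N. finite (\<Psi> N) \<and> \<Psi> N \<noteq> {} \<and> \<Psi> N \<subseteq> carrier H) \<and>
     (\<forall>g\<in>carrier H.
        (\<lambda>N. real (card (\<Psi> N \<inter> (g <#\<^bsub>H\<^esub> \<Psi> N))) / real (card (\<Psi> N))) \<longlonglongrightarrow> 1)"

definition amenable :: "('a, 'm) monoid_scheme \<Rightarrow> bool" where
  "amenable H \<longleftrightarrow> (\<exists>\<Psi>. left_Folner_seq H \<Psi>)"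

text \<open>
  The limit superior is taken in the extended reals, because \<open>limsup\<close> requires a
  complete linear order. All terms lie in \<open>[0, 1]\<close>, so no information is lost by
  converting back to a real number; see \<open>ereal_upper_density\<close>.
\<close>

definition upper_density :: "(nat \<Rightarrow> 'a set) \<Rightarrow> 'a set \<Rightarrow> real" where
  "upper_density \<Psi> A =
     real_of_ereal (limsup (\<lambda>N. ereal (real (card (A \<inter> \<Psi> N)) / real (card (\<Psi> N)))))"

lemma ereal_upper_density:
  assumes "\<And>N. finite (\<Psi> N)"
  shows "ereal (upper_density \<Psi> A) =
     limsup (\<lambda>N. ereal (real (card (A \<inter> \<Psi> N)) / real (card (\<Psi> N))))"
proof -
  let ?f = "\<lambda>N. ereal (real (card (A \<inter> \<Psi> N)) / real (card (\<Psi> N)))"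
  have "real (card (A \<inter> \<Psi> N)) / real (card (\<Psi> N)) \<le> 1" for N
    using assms by (intro divide_le_eq_1[THEN iffD2]) (auto intro: card_mono simp: card_gt_0_iff)
  then have "limsup ?f \<le> 1"
    by (intro Limsup_bounded) (auto simp: one_ereal_def)
  moreover have "0 \<le> limsup ?f"
    by (intro le_Limsup) (auto simp: zero_ereal_def)
  ultimately show ?thesis
    unfolding upper_density_def by (cases "limsup ?f") auto
qed

definition left_syndetic :: "('a, 'm) monoid_scheme \<Rightarrow> 'a set \<Rightarrow> bool" where
  "left_syndetic H S \<longleftrightarrow> S \<subseteq> carrier H \<and>
     (\<exists>F. finite F \<and> F \<subseteq> carrier H \<and> carrier H = (\<Union>g\<in>F. g <#\<^bsub>H\<^esub> S))"

definition right_syndetic :: "('a, 'm) monoid_scheme \<Rightarrow> 'a set \<Rightarrow> bool" where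
  "right_syndetic H S \<longleftrightarrow> S \<subseteq> carrier H \<and>
     (\<exists>F. finite F \<and> F \<subseteq> carrier H \<and> carrier H = (\<Union>g\<in>F. S #>\<^bsub>H\<^esub> g))"

text \<open>
  Elements of the \<open>d\<close>-th cartesian power are functions on \<open>{1..d}\<close> that are
  \<open>undefined\<close> outside that set.
\<close>

definition power_group :: "('a, 'm) monoid_scheme \<Rightarrow> nat \<Rightarrow> (nat \<Rightarrow> 'a) monoid" where
  "power_group G d = product_group {1..d} (\<lambda>_. G)"

text \<open>The set written \<open>h.g\<close> in the literature.\<close>

definition cube :: "('a, 'm) monoid_scheme \<Rightarrow> nat \<Rightarrow> (nat \<Rightarrow> 'a) \<Rightarrow> (nat \<Rightarrow> 'a) \<Rightarrow> (nat \<Rightarrow> 'a) set" where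
  "cube G d h g =
     {(\<lambda>i\<in>{1..d}. (h i [^]\<^bsub>G\<^esub> (- \<epsilon> i)) \<otimes>\<^bsub>G\<^esub> g i) | \<epsilon> :: nat \<Rightarrow> int.
        \<epsilon> \<in> {1..d} \<rightarrow>\<^sub>E {0, 1}}"

end

theory Submission
  imports Defs
begin

text \<open>
  Choose a left-invariant mean \<open>\<mu>\<close> on the power group \<open>H\<close> along a subsequence of the given Folner sequence
  that realises the upper density of \<open>E\<close>, and let \<open>K(h) = \<mu>{g. h.g \<subseteq> E}\<close>. This function is symmetric
  under \<open>h \<mapsto> h\<^sup>-\<^sup>1\<close> and, in each coordinate separately, positive definite on \<open>G\<close>, being there an
  autocorrelation \<open>b \<mapsto> \<mu>(B \<inter> bB)\<close>.

  For a positive definite \<open>\<phi>\<close> on \<open>G\<close> with invariant mean value \<open>M \<phi>\<close>, the function \<open>\<phi> - M \<phi>\<close> is again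
  positive definite, and \<open>M \<phi>\<close> is the infimum of the averages of \<open>\<phi>(b\<^sub>i\<^sup>-\<^sup>1b\<^sub>j)\<close> over finite
  configurations. The second fact gives \<open>M\<^sub>jM\<^sub>iK \<le> M\<^sub>iM\<^sub>jK\<close> for the means in two coordinates;
  with the first, by induction on the number of coordinates, every invariant mean \<open>m\<close> on \<open>H\<close>
  satisfies \<open>m(K) = M\<^sub>1\<cdots>M\<^sub>dK\<close>. The iterated mean is at least \<open>\<mu>(E)^(2^d)\<close>
  by applying Cauchy-Schwarz in one coordinate at a time.

  If \<open>{h. K(h) > \<mu>(E)^(2^d) - c}\<close> were not left-syndetic, its complement would carry a left-invariant
  mean, for which \<open>m(K) \<le> \<mu>(E)^(2^d) - c\<close>, a contradiction. Right-syndeticity follows from the symmetry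
  of \<open>K\<close>.
\<close>

section \<open>Means and Folner sequences\<close>

text \<open>Boundedness is demanded on the whole type, so it survives every substitution of the
  argument, with no need to check that the substitution stays inside a carrier.\<close>

definition bdd :: "('x \<Rightarrow> real) \<Rightarrow> bool" where
  "bdd f \<longleftrightarrow> (\<exists>C. \<forall>x. \<bar>f x\<bar> \<le> C)"

named_theorems bdd_intros

lemma bdd_const [bdd_intros, simp]: "bdd (\<lambda>_. c)"
  unfolding bdd_def by auto

lemma bdd_add [bdd_intros]: "bdd f \<Longrightarrow> bdd g \<Longrightarrow> bdd (\<lambda>x. f x + g x)"
  unfolding bdd_def
proof (elim exE)
  fix C D assume "\<forall>x. \<bar>f x\<bar> \<le> C" "\<forall>x. \<bar>g x\<bar> \<le> D"
  then have "\<bar>f x + g x\<bar> \<le> C + D" for x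
    using abs_triangle_ineq[of "f x" "g x"] add_mono[of "\<bar>f x\<bar>" C "\<bar>g x\<bar>" D] by auto
  then show "\<exists>C. \<forall>x. \<bar>f x + g x\<bar> \<le> C" by blast
qed

lemma bdd_mult [bdd_intros]: "bdd f \<Longrightarrow> bdd g \<Longrightarrow> bdd (\<lambda>x. f x * g x)"
  unfolding bdd_def
proof (elim exE)
  fix C D assume C: "\<forall>x. \<bar>f x\<bar> \<le> C" and D: "\<forall>x. \<bar>g x\<bar> \<le> D"
  have "\<bar>f x * g x\<bar> \<le> C * D" for x
    unfolding abs_mult using C[rule_format, of x] D[rule_format, of x]
    by (intro mult_mono) (auto intro: order_trans[OF abs_ge_zero])
  then show "\<exists>C. \<forall>x. \<bar>f x * g x\<bar> \<le> C" by blast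
qed

lemma bdd_diff [bdd_intros]: "bdd f \<Longrightarrow> bdd g \<Longrightarrow> bdd (\<lambda>x. f x - g x)"
  using bdd_add[of f "\<lambda>x. (-1) * g x"] bdd_mult[of "\<lambda>_. -1" g] by simp

lemma bdd_power [bdd_intros]: "bdd f \<Longrightarrow> bdd (\<lambda>x. f x ^ n)"
  by (induction n) (auto intro: bdd_intros)

lemma bdd_of_bool [bdd_intros]: "bdd (\<lambda>x. of_bool (P x))"
  unfolding bdd_def by (rule exI[of _ 1]) auto

lemma bdd_sum_list [bdd_intros]:
  "(\<And>a. a \<in> set xs \<Longrightarrow> bdd (f a)) \<Longrightarrow> bdd (\<lambda>x. \<Sum>a\<leftarrow>xs. f a x)"
  by (induction xs) (auto intro: bdd_intros)

lemma bdd_comp: "bdd f \<Longrightarrow> bdd (\<lambda>x. f (t x))"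
  unfolding bdd_def by auto

text \<open>\<open>M\<close> is total, but its laws concern bounded functions. The set
  \<open>X\<close> enters only through \<open>mono\<close>, which makes \<open>M\<close> blind to
  the values of bounded functions outside \<open>X\<close>.\<close>

locale mean =
  fixes X :: "'x set" and M :: "('x \<Rightarrow> real) \<Rightarrow> real"
  assumes add: "bdd f \<Longrightarrow> bdd g \<Longrightarrow> M (\<lambda>x. f x + g x) = M f + M g"
    and scale: "bdd f \<Longrightarrow> M (\<lambda>x. c * f x) = c * M f"
    and mono: "bdd f \<Longrightarrow> bdd g \<Longrightarrow> (\<And>x. x \<in> X \<Longrightarrow> f x \<le> g x) \<Longrightarrow> M f \<le> M g"
    and one: "M (\<lambda>_. 1) = 1"
begin

lemma const [simp]: "M (\<lambda>_. c) = c"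
  using scale[of "\<lambda>_. 1" c] one by simp

lemma cong: "bdd f \<Longrightarrow> bdd g \<Longrightarrow> (\<And>x. x \<in> X \<Longrightarrow> f x = g x) \<Longrightarrow> M f = M g"
  by (intro antisym mono) auto

lemma diff: "bdd f \<Longrightarrow> bdd g \<Longrightarrow> M (\<lambda>x. f x - g x) = M f - M g"
  using add[of f "\<lambda>x. (-1) * g x"] scale[of g "-1"] bdd_mult[of "\<lambda>_. -1" g] by simp

lemma sum_list:
  "(\<And>a. a \<in> set xs \<Longrightarrow> bdd (f a)) \<Longrightarrow> M (\<lambda>x. \<Sum>a\<leftarrow>xs. f a x) = (\<Sum>a\<leftarrow>xs. M (f a))"
  by (induction xs) (auto simp: add bdd_sum_list)

lemma abs_le: 
  assumes "\<And>x. \<bar>f x\<bar> \<le> C"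
  shows "\<bar>M f\<bar> \<le> C"
proof -
  have "bdd f" using assms unfolding bdd_def by auto
  have "f x \<le> C" "- C \<le> f x" for x
    using assms[of x] by auto
  then show ?thesis
    using mono[of f "\<lambda>_. C"] mono[of "\<lambda>_. - C" f] \<open>bdd f\<close> by auto
qed

lemma ge_const: "bdd f \<Longrightarrow> (\<And>x. x \<in> X \<Longrightarrow> c \<le> f x) \<Longrightarrow> c \<le> M f"
  using mono[of "\<lambda>_. c" f] by simp

lemma exists_le:
  assumes "bdd f" "e > 0"
  shows "\<exists>x\<in>X. f x \<le> M f + e"
proof (rule ccontr)
  assume "\<not> ?thesis"
  then have "M f + e \<le> M f"
    using assms(1) by (intro ge_const) (auto simp: not_le less_imp_le)
  with assms(2) show False by simp
qed

text \<open>The variance of \<open>f\<close> under \<open>M\<close> is nonnegative.\<close>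

lemma square_le:
  assumes "bdd f"
  shows "(M f)\<^sup>2 \<le> M (\<lambda>x. (f x)\<^sup>2)"
proof -
  have "0 \<le> M (\<lambda>x. (f x - M f)\<^sup>2)"
    using assms by (intro ge_const bdd_intros) auto
  also have "(\<lambda>x. (f x - M f)\<^sup>2) = (\<lambda>x. (f x)\<^sup>2 - (2 * M f) * f x + (M f)\<^sup>2)"
    by (auto simp: power2_diff)
  also have "M \<dots> = M (\<lambda>x. (f x)\<^sup>2) - (2 * M f) * M f + (M f)\<^sup>2"
    using assms by (subst add diff scale; (intro bdd_intros)?; simp)+
  finally show ?thesis
    by (simp add: power2_eq_square)
qed

end

locale left_mean = group G + mean "carrier G" M for G (structure) and M +
  assumes translate: "bdd f \<Longrightarrow> a \<in> carrier G \<Longrightarrow> M (\<lambda>x. f (a \<otimes> x)) = M f"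

section \<open>Ultralimits of averages\<close>

text \<open>A proper filter that is minimal with respect to \<open>\<le>\<close> decides every predicate.\<close>

lemma exists_ultrafilter:
  fixes F0 :: "'x filter"
  assumes "F0 \<noteq> bot"
  shows "\<exists>U\<le>F0. U \<noteq> bot \<and> (\<forall>P. eventually P U \<or> eventually (\<lambda>x. \<not> P x) U)"
proof -
  let ?A = "{F. F \<noteq> bot \<and> F \<le> F0}"
  have "\<exists>m\<in>?A. \<forall>a\<in>?A. m \<ge> a \<longrightarrow> a = m"
  proof (rule predicate_Zorn)
    show "partial_order_on ?A (relation_of (\<ge>) ?A)"
      by (auto simp: partial_order_on_def preorder_on_def relation_of_def refl_on_def trans_def antisym_def)
    fix C assume C: "C \<in> Chains (relation_of (\<ge>) ?A)"
    then have CA: "C \<subseteq> ?A" and ch: "\<And>F G. F \<in> C \<Longrightarrow> G \<in> C \<Longrightarrow> F \<le> G \<or> G \<le> F"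
      by (auto simp: Chains_def relation_of_def)
    show "\<exists>u\<in>?A. \<forall>a\<in>C. u \<le> a"
    proof (cases "C = {}")
      case True
      then show ?thesis using assms by auto
    next
      case False
      have "\<exists>H\<in>C. H \<le> inf F G" if "F \<in> C" "G \<in> C" for F G
        using ch[OF that] that by auto
      then have ev: "eventually P (Inf C) \<longleftrightarrow> (\<exists>b\<in>C. eventually P b)" for P
        using False by (intro eventually_Inf_base)
      have "Inf C \<noteq> bot"
        using ev[of "\<lambda>_. False"] CA by (auto simp: trivial_limit_def)
      moreover have "Inf C \<le> F0"
      proof -
        obtain F where "F \<in> C" using False by auto
        with CA show ?thesis by (intro Inf_lower2[of F]) auto
      qed
      ultimately show ?thesis
        by (intro bexI[of _ "Inf C"]) (auto intro: Inf_lower)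
    qed
  qed
  then obtain U where U: "U \<noteq> bot" "U \<le> F0" and min: "\<And>F. F \<noteq> bot \<Longrightarrow> F \<le> U \<Longrightarrow> F = U"
    by auto
  have "eventually P U \<or> eventually (\<lambda>x. \<not> P x) U" for P
  proof (rule ccontr)
    assume *: "\<not> ?thesis"
    \<comment> \<open>Restricting \<open>U\<close> to \<open>P\<close> would be improper only if the
      negation of \<open>P\<close> held eventually; a proper restriction equals \<open>U\<close> by
      minimality.\<close>
    have "inf U (principal {x. P x}) \<noteq> bot"
      using * by (auto simp: trivial_limit_def eventually_inf_principal)
    then have "inf U (principal {x. P x}) = U"
      by (intro min) auto
    moreover have "eventually P (inf U (principal {x. P x}))"
      by (simp add: eventually_inf_principal)
    ultimately show False using * by simp
  qed
  with U show ?thesis by blast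
qed

text \<open>The limit is the supremum of all \<open>r\<close> that are eventually lower bounds of
  \<open>f\<close>: above it the ultrafilter must decide each threshold negatively.\<close>

lemma ultrafilter_tendsto:
  assumes "U \<noteq> bot" "\<And>P. eventually P U \<or> eventually (\<lambda>x. \<not> P x) U" "bdd f"
  shows "(f \<longlongrightarrow> Lim U f) U"
proof -
  obtain C where C: "\<bar>f x\<bar> \<le> C" for x
    using assms(3) unfolding bdd_def by auto
  let ?S = "{r. eventually (\<lambda>x. r \<le> f x) U}"
  have "-C \<le> f x" for x
    using C[of x] by linarith
  then have ne: "-C \<in> ?S"
    by simp
  have "r \<le> C" if "r \<in> ?S" for r
  proof -
    have "eventually (\<lambda>x. r \<le> f x) U" using that by simp
    then obtain x where "r \<le> f x"
      using assms(1) eventually_happens' by blast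
    then show ?thesis using C[of x] by linarith
  qed
  then have bdd: "bdd_above ?S"
    by (auto simp: bdd_above_def)
  have "(f \<longlongrightarrow> Sup ?S) U"
  proof (rule order_tendstoI)
    fix a assume "a < Sup ?S"
    then obtain r where "r \<in> ?S" "a < r"
      using less_cSupD[of ?S a] ne by blast
    then show "eventually (\<lambda>x. a < f x) U"
      by (auto elim: eventually_mono)
  next
    fix a assume "Sup ?S < a"
    then have "a \<notin> ?S"
      using cSup_upper[OF _ bdd] by force
    then have "eventually (\<lambda>x. \<not> a \<le> f x) U"
      using assms(2)[of "\<lambda>x. a \<le> f x"] by auto
    then show "eventually (\<lambda>x. f x < a) U"
      by (simp add: not_le)
  qed
  with assms(1) show ?thesis
    by (simp add: tendsto_Lim)
qed

text \<open>The mean is the ultralimit of the averages over \<open>\<Phi> N\<close>. The second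
  clause records all that is kept of this construction; applied to negated functions it also yields
  lower bounds.\<close>

lemma exists_Folner_mean:
  fixes H (structure)
  assumes H: "group H" and \<Phi>: "left_Folner_seq H \<Phi>"
  shows "\<exists>M. left_mean H M \<and>
    (\<forall>f L. bdd f \<longrightarrow> eventually (\<lambda>N. sum f (\<Phi> N) / card (\<Phi> N) \<le> L) sequentially \<longrightarrow> M f \<le> L)"
proof -
  interpret group H by (rule H)
  have fin: "finite (\<Phi> N)" "\<Phi> N \<noteq> {}" "\<Phi> N \<subseteq> carrier H" for N
    using \<Phi> by (auto simp: left_Folner_seq_def)
  have inv: "(\<lambda>N. real (card (\<Phi> N \<inter> (g <# \<Phi> N))) / real (card (\<Phi> N))) \<longlonglongrightarrow> 1"
    if "g \<in> carrier H" for g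
    using \<Phi> that by (auto simp: left_Folner_seq_def)
  obtain U :: "nat filter" where U: "U \<le> sequentially" "U \<noteq> bot"
    and ultra: "\<And>P. eventually P U \<or> eventually (\<lambda>x. \<not> P x) U"
    using exists_ultrafilter[of sequentially] by auto
  define A where "A f N = sum f (\<Phi> N) / card (\<Phi> N)" for f N
  have cpos: "card (\<Phi> N) > 0" for N
    using fin by (simp add: card_gt_0_iff)
  have abs_sum: "\<bar>sum f S\<bar> \<le> C * card S" if "\<And>x. \<bar>f x\<bar> \<le> C" for f :: "'a \<Rightarrow> real" and S C
    using sum_norm_bound[of S f C] that by (simp add: mult.commute)
  have bA: "bdd (A f)" if f: "bdd f" for f
  proof -
    obtain C where C: "\<bar>f x\<bar> \<le> C" for x
      using f unfolding bdd_def by auto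
    have "\<bar>sum f (\<Phi> N)\<bar> \<le> C * card (\<Phi> N)" for N
      by (rule abs_sum[OF C])
    then have "\<bar>A f N\<bar> \<le> C" for N
      using cpos[of N] by (simp add: A_def divide_simps)
    then show ?thesis unfolding bdd_def by auto
  qed
  define M where "M f = Lim U (A f)" for f
  have lim: "(A f \<longlongrightarrow> M f) U" if "bdd f" for f
    unfolding M_def using ultrafilter_tendsto[OF U(2) ultra bA[OF that]] .
  have unique: "M f = L" if "bdd f" "(A f \<longlongrightarrow> L) U" for f L
    using tendsto_unique[OF U(2) lim[OF that(1)] that(2)] .
  have "mean (carrier H) M"
  proof
    fix f g :: "'a \<Rightarrow> real" assume "bdd f" "bdd g"
    moreover have "A (\<lambda>x. f x + g x) = (\<lambda>N. A f N + A g N)"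
      by (auto simp: A_def sum.distrib add_divide_distrib)
    ultimately show "M (\<lambda>x. f x + g x) = M f + M g"
      by (auto intro!: unique bdd_intros tendsto_add lim)
  next
    fix f :: "'a \<Rightarrow> real" and c assume "bdd f"
    moreover have "A (\<lambda>x. c * f x) = (\<lambda>N. c * A f N)"
      by (auto simp: A_def sum_distrib_left)
    ultimately show "M (\<lambda>x. c * f x) = c * M f"
      by (auto intro!: unique bdd_intros tendsto_mult_left lim)
  next
    fix f g :: "'a \<Rightarrow> real" assume "bdd f" "bdd g" and le: "\<And>x. x \<in> carrier H \<Longrightarrow> f x \<le> g x"
    have "A f N \<le> A g N" for N
      unfolding A_def using fin(3)[of N] le by (intro divide_right_mono sum_mono) auto
    then show "M f \<le> M g"
      using tendsto_le[OF U(2) lim[OF \<open>bdd g\<close>] lim[OF \<open>bdd f\<close>]] by auto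
  next
    have "A (\<lambda>_. 1) = (\<lambda>_. 1)"
      using cpos by (auto simp: A_def)
    then show "M (\<lambda>_. 1) = 1"
      by (intro unique) auto
  qed
  moreover have "M (\<lambda>x. f (g \<otimes> x)) = M f" if g: "g \<in> carrier H" and f: "bdd f" for g f
  proof -
    obtain C where C: "\<bar>f x\<bar> \<le> C" for x
      using f unfolding bdd_def by auto
    define q where "q N = real (card (\<Phi> N \<inter> (g <# \<Phi> N))) / real (card (\<Phi> N))" for N
    \<comment> \<open>Translation changes the sum only on the two halves of the symmetric difference
      of \<open>\<Phi> N\<close> and its translate, each of relative size
      \<open>1 - q N\<close>.\<close>
    have bound: "\<bar>A (\<lambda>x. f (g \<otimes> x)) N - A f N\<bar> \<le> 2 * C * (1 - q N)" for N
    proof -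
      let ?S = "\<Phi> N" let ?T = "g <# \<Phi> N"
      have T: "?T = (\<lambda>x. g \<otimes> x) ` ?S"
        by (auto simp: l_coset_def)
      have inj: "inj_on (\<lambda>x. g \<otimes> x) ?S"
        using inj_on_subset[OF inj_on_cmult[OF g] fin(3)[of N]] .
      have finT: "finite ?T" and cT: "card ?T = card ?S"
        using T inj fin by (auto simp: card_image)
      have "sum (\<lambda>x. f (g \<otimes> x)) ?S = sum f ?T"
        unfolding T using inj by (simp add: sum.reindex)
      then have "\<bar>sum (\<lambda>x. f (g \<otimes> x)) ?S - sum f ?S\<bar> = \<bar>sum f (?T - ?S) - sum f (?S - ?T)\<bar>"
        using sum.Int_Diff[OF finT, of f ?S] sum.Int_Diff[OF fin(1)[of N], of f ?T]
        by (simp add: Int_commute)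
      also have "\<dots> \<le> C * card (?T - ?S) + C * card (?S - ?T)"
      proof -
        have "\<bar>sum f (?T - ?S)\<bar> \<le> C * card (?T - ?S)" "\<bar>sum f (?S - ?T)\<bar> \<le> C * card (?S - ?T)"
          by (rule abs_sum[OF C])+
        then show ?thesis by linarith
      qed
      also have "real (card (?T - ?S)) = real (card ?S) - card (?S \<inter> ?T)"
        using card_Diff_subset_Int[of ?T ?S] finT fin(1)[of N] cT card_mono[of ?S "?S \<inter> ?T"]
        by (simp add: Int_commute of_nat_diff)
      also have "real (card (?S - ?T)) = real (card ?S) - card (?S \<inter> ?T)"
        using card_Diff_subset_Int[of ?S ?T] finT fin(1)[of N] cT card_mono[of ?S "?S \<inter> ?T"]
        by (simp add: of_nat_diff)
      finally have "\<bar>sum (\<lambda>x. f (g \<otimes> x)) ?S - sum f ?S\<bar> / card ?S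
          \<le> (2 * C * (real (card ?S) - card (?S \<inter> ?T))) / card ?S"
        by (intro divide_right_mono) auto
      then show ?thesis
        using cpos[of N] by (simp add: A_def q_def abs_divide field_simps flip: diff_divide_distrib)
    qed
    have "(\<lambda>N. 2 * C * (1 - q N)) \<longlonglongrightarrow> 2 * C * (1 - 1)"
      using inv[OF g] unfolding q_def by (intro tendsto_intros)
    then have "(\<lambda>N. 2 * C * (1 - q N)) \<longlonglongrightarrow> 0"
      by simp
    then have "(\<lambda>N. A (\<lambda>x. f (g \<otimes> x)) N - A f N) \<longlonglongrightarrow> 0"
    proof (rule tendsto_0_le[where K = 1], intro always_eventually allI)
      fix N
      show "norm (A (\<lambda>x. f (g \<otimes> x)) N - A f N) \<le> norm (2 * C * (1 - q N)) * 1"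
        unfolding real_norm_def mult_1_right using bound[of N] abs_ge_self by (rule order_trans)
    qed
    then have "((\<lambda>N. A (\<lambda>x. f (g \<otimes> x)) N - A f N) \<longlongrightarrow> 0) U"
      using U(1) by (rule tendsto_mono[rotated])
    from tendsto_add[OF this lim[OF f]] have "(A (\<lambda>x. f (g \<otimes> x)) \<longlongrightarrow> M f) U"
      by simp
    with bdd_comp[OF f] show ?thesis
      by (rule unique)
  qed
  moreover have "M f \<le> L" if "bdd f" "eventually (\<lambda>N. A f N \<le> L) sequentially" for f L
    using lim[OF that(1)] filter_leD[OF U(1) that(2)] U(2) by (rule tendsto_upperbound)
  ultimately show ?thesis
    unfolding A_def using H
    by (intro exI[of _ M]) (simp add: left_mean_def left_mean_axioms_def)
qed

section \<open>Positive definite functions\<close>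

context group
begin

text \<open>The bilinear form of the kernel \<open>\<phi> (inv a \<otimes> b)\<close>. Finitely
  supported vectors are lists of weighted points, repetitions allowed, so that addition of vectors
  is concatenation.\<close>

definition qform :: "('a \<Rightarrow> real) \<Rightarrow> (real \<times> 'a) list \<Rightarrow> (real \<times> 'a) list \<Rightarrow> real" where
  "qform \<phi> xs ys = (\<Sum>(c, a)\<leftarrow>xs. \<Sum>(e, b)\<leftarrow>ys. c * e * \<phi> (inv a \<otimes> b))"

text \<open>Symmetry is a separate clause because a real quadratic form sees only the symmetric part
  of its kernel.\<close>

definition positive_definite :: "('a \<Rightarrow> real) \<Rightarrow> bool" where
  "positive_definite \<phi> \<longleftrightarrow> (\<forall>a\<in>carrier G. \<phi> (inv a) = \<phi> a) \<and>
     (\<forall>xs. snd ` set xs \<subseteq> carrier G \<longrightarrow> 0 \<le> qform \<phi> xs xs)"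

lemma qform_Nil [simp]: "qform \<phi> [] ys = 0" "qform \<phi> xs [] = 0"
  by (simp_all add: qform_def case_prod_unfold)

lemma qform_append:
  "qform \<phi> (xs @ xs') ys = qform \<phi> xs ys + qform \<phi> xs' ys"
  "qform \<phi> xs (ys @ ys') = qform \<phi> xs ys + qform \<phi> xs ys'"
  by (simp_all add: qform_def case_prod_unfold sum_list_addf)

lemma qform_commute:
  assumes "\<And>a. a \<in> carrier G \<Longrightarrow> \<phi> (inv a) = \<phi> a"
    and "snd ` set xs \<subseteq> carrier G" "snd ` set ys \<subseteq> carrier G"
  shows "qform \<phi> xs ys = qform \<phi> ys xs"
  using assms(2)
proof (induction xs)
  case (Cons x xs)
  have "qform \<phi> [x] ys = qform \<phi> ys [x]"
    using assms(3) Cons.prems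
  proof (induction ys)
    case (Cons y ys)
    then have "\<phi> (inv (snd x) \<otimes> snd y) = \<phi> (inv (snd y) \<otimes> snd x)"
      using assms(1)[of "inv (snd x) \<otimes> snd y"] by (simp add: inv_mult_group)
    with Cons show ?case
      by (simp add: qform_def case_prod_unfold)
  qed simp
  with Cons show ?case
    using qform_append(1)[of \<phi> "[x]" xs ys] qform_append(2)[of \<phi> ys "[x]" xs] by simp
qed simp

lemma qform_diff_const: "qform (\<lambda>a. \<phi> a - k) xs xs = qform \<phi> xs xs - k * (\<Sum>(c, a)\<leftarrow>xs. c)\<^sup>2"
proof -
  \<comment> \<open>Two independent lists allow an induction on the first while the second stays
    fixed.\<close>
  have "qform (\<lambda>a. \<phi> a - k) xs ys = qform \<phi> xs ys - k * ((\<Sum>(c, a)\<leftarrow>xs. c) * (\<Sum>(c, a)\<leftarrow>ys. c))" for ys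
  proof (induction xs)
    case (Cons x xs)
    have "(\<Sum>(e, b)\<leftarrow>ys. fst x * e * (\<phi> (inv (snd x) \<otimes> b) - k)) =
        (\<Sum>(e, b)\<leftarrow>ys. fst x * e * \<phi> (inv (snd x) \<otimes> b)) - k * (fst x * (\<Sum>(c, a)\<leftarrow>ys. c))"
      by (induction ys) (auto simp: algebra_simps)
    with Cons show ?case
      by (simp add: qform_def case_prod_unfold algebra_simps)
  qed simp
  then show ?thesis
    by (simp add: power2_eq_square)
qed

lemma bdd_qform [bdd_intros]:
  "(\<And>a. bdd (\<lambda>x. \<phi> x a)) \<Longrightarrow> bdd (\<lambda>x. qform (\<phi> x) xs ys)"
  unfolding qform_def case_prod_unfold by (intro bdd_intros) auto

lemma mean_qform:
  assumes "mean X M" "\<And>a. bdd (\<lambda>x. \<phi> x a)"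
  shows "M (\<lambda>x. qform (\<phi> x) xs ys) = qform (\<lambda>a. M (\<lambda>x. \<phi> x a)) xs ys"
proof -
  interpret mean X M by (rule assms(1))
  show ?thesis
    unfolding qform_def case_prod_unfold
    by (subst sum_list, (intro bdd_intros assms(2)), subst sum_list, (intro bdd_intros assms(2)),
        subst scale) (auto intro: assms(2))
qed

lemma positive_definite_mean:
  assumes "mean X M" "\<And>a. bdd (\<lambda>x. \<phi> x a)" "\<And>x. x \<in> X \<Longrightarrow> positive_definite (\<phi> x)"
  shows "positive_definite (\<lambda>a. M (\<lambda>x. \<phi> x a))"
proof -
  interpret mean X M by (rule assms(1))
  show ?thesis
    unfolding positive_definite_def
    using assms(2,3)
    by (auto simp: positive_definite_def mean_qform[OF assms(1,2), symmetric]
        intro!: cong ge_const bdd_qform)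
qed

text \<open>A probability vector: \<open>qform\<close> at these weights is the plain average of
  \<open>\<phi> (inv a \<otimes> b)\<close> over all ordered pairs of points, diagonal
  included.\<close>

definition uniform_weights :: "'a list \<Rightarrow> (real \<times> 'a) list" where
  "uniform_weights bs = map (Pair (1 / length bs)) bs"

lemma sum_uniform_weights: "bs \<noteq> [] \<Longrightarrow> (\<Sum>(c, a)\<leftarrow>uniform_weights bs. c) = 1"
  by (simp add: uniform_weights_def comp_def sum_list_triv)

lemma snd_uniform_weights [simp]: "snd ` set (uniform_weights bs) = set bs"
  by (auto simp: uniform_weights_def image_iff)

end

section \<open>Means as limits of averages over finite configurations\<close>

context left_mean
begin

text \<open>The points are chosen one after the other: by left invariance the expected increment from a
  new point depends only on the means. Only the diagonal terms \<open>\<psi> \<one>\<close> escape, and they are negligible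
  after dividing by the square of the number of points.\<close>

lemma exists_small_sums:
  assumes "bdd \<theta>" "bdd \<psi>" and sym: "\<And>a. a \<in> carrier G \<Longrightarrow> \<psi> (inv a) = \<psi> a"
  shows "\<exists>bs. length bs = n \<and> set bs \<subseteq> carrier G \<and>
    (\<Sum>b\<leftarrow>bs. \<theta> b) + (\<Sum>a\<leftarrow>bs. \<Sum>b\<leftarrow>bs. \<psi> (inv a \<otimes> b))
      \<le> real n * M \<theta> + (real n)\<^sup>2 * M \<psi> + n * (\<psi> \<one> - M \<psi> + 1)"
proof (induction n)
  case (Suc n)
  then obtain bs where len: "length bs = n" and bs: "set bs \<subseteq> carrier G" and
    le: "(\<Sum>b\<leftarrow>bs. \<theta> b) + (\<Sum>a\<leftarrow>bs. \<Sum>b\<leftarrow>bs. \<psi> (inv a \<otimes> b))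
      \<le> real n * M \<theta> + (real n)\<^sup>2 * M \<psi> + n * (\<psi> \<one> - M \<psi> + 1)" by blast
  \<comment> \<open>The increment of the left-hand side when \<open>b\<close> is prepended to
    \<open>bs\<close>: the new diagonal term is \<open>\<psi> \<one>\<close>, and symmetry merges
    the two off-diagonal sums.\<close>
  let ?f = "\<lambda>b. \<theta> b + (\<psi> \<one> + 2 * (\<Sum>a\<leftarrow>bs. \<psi> (inv a \<otimes> b)))"
  have b2: "bdd (\<lambda>b. \<Sum>a\<leftarrow>bs. \<psi> (inv a \<otimes> b))"
    by (intro bdd_intros bdd_comp[OF assms(2)])
  have "M (\<lambda>b. \<Sum>a\<leftarrow>bs. \<psi> (inv a \<otimes> b)) = (\<Sum>a\<leftarrow>bs. M (\<lambda>b. \<psi> (inv a \<otimes> b)))"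
    by (intro sum_list bdd_comp[OF assms(2)])
  also have "\<dots> = (\<Sum>a\<leftarrow>bs. M \<psi>)"
    using bs by (intro arg_cong[of _ _ sum_list] map_cong refl translate[OF assms(2)]) auto
  finally have "M (\<lambda>b. \<Sum>a\<leftarrow>bs. \<psi> (inv a \<otimes> b)) = n * M \<psi>"
    by (simp add: sum_list_triv len)
  then have Mf: "M ?f = M \<theta> + (\<psi> \<one> + 2 * (n * M \<psi>))"
    using assms b2 by (simp add: add scale bdd_add bdd_mult)
  obtain b where b: "b \<in> carrier G" "?f b \<le> M ?f + 1"
  proof -
    have "bdd ?f"
      by (intro bdd_intros assms(1) b2)
    \<comment> \<open>This slack of 1 per point is the \<open>+ 1\<close> in the error term.\<close>
    from exists_le[OF this, of 1] that show ?thesis by auto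
  qed
  have "(\<Sum>a\<leftarrow>bs. \<psi> (inv b \<otimes> a)) = (\<Sum>a\<leftarrow>bs. \<psi> (inv a \<otimes> b))"
  proof (intro arg_cong[of _ _ sum_list] map_cong refl)
    fix a assume "a \<in> set bs"
    then show "\<psi> (inv b \<otimes> a) = \<psi> (inv a \<otimes> b)"
      using sym[of "inv a \<otimes> b"] b bs by (auto simp: inv_mult_group subset_iff)
  qed
  then have "(\<Sum>b\<leftarrow>b#bs. \<theta> b) + (\<Sum>a\<leftarrow>b#bs. \<Sum>b\<leftarrow>b#bs. \<psi> (inv a \<otimes> b)) =
      ((\<Sum>b\<leftarrow>bs. \<theta> b) + (\<Sum>a\<leftarrow>bs. \<Sum>b\<leftarrow>bs. \<psi> (inv a \<otimes> b))) + ?f b"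
    using b by (simp add: sum_list_addf)
  also have "\<dots> \<le> real (Suc n) * M \<theta> + (real (Suc n))\<^sup>2 * M \<psi> + Suc n * (\<psi> \<one> - M \<psi> + 1)"
    using le b(2) unfolding Mf by (simp add: algebra_simps power2_eq_square)
  finally show ?case
    using len b bs by (intro exI[of _ "b # bs"]) auto
qed simp

text \<open>Scaling \<open>\<theta>\<close> by \<open>n\<close> brings both main terms to the order
  of the square of \<open>n\<close>, while the error is linear in \<open>n\<close>; after division
  it drops below \<open>e\<close> for large \<open>n\<close>.\<close>

lemma exists_small_average:
  assumes "bdd \<theta>" "bdd \<psi>" and sym: "\<And>a. a \<in> carrier G \<Longrightarrow> \<psi> (inv a) = \<psi> a" and "e > 0"
  shows "\<exists>bs. bs \<noteq> [] \<and> set bs \<subseteq> carrier G \<and>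
    (\<Sum>b\<leftarrow>bs. \<theta> b) / length bs + qform \<psi> (uniform_weights bs) (uniform_weights bs)
      \<le> M \<theta> + M \<psi> + e"
proof -
  obtain n :: nat where n: "n > 0" "(\<psi> \<one> - M \<psi> + 1) / e < n"
    using reals_Archimedean2[of "max 0 ((\<psi> \<one> - M \<psi> + 1) / e)"] by auto
  obtain bs where len: "length bs = n" and bs: "set bs \<subseteq> carrier G" and
    le: "(\<Sum>b\<leftarrow>bs. n * \<theta> b) + (\<Sum>a\<leftarrow>bs. \<Sum>b\<leftarrow>bs. \<psi> (inv a \<otimes> b))
      \<le> real n * M (\<lambda>b. n * \<theta> b) + (real n)\<^sup>2 * M \<psi> + n * (\<psi> \<one> - M \<psi> + 1)"
  proof -
    have "bdd (\<lambda>b. n * \<theta> b)"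
      by (intro bdd_intros assms(1))
    from exists_small_sums[OF this assms(2) sym, of n] that show ?thesis by blast
  qed
  have q: "qform \<psi> (uniform_weights bs) (uniform_weights bs) =
      (\<Sum>a\<leftarrow>bs. \<Sum>b\<leftarrow>bs. \<psi> (inv a \<otimes> b)) / (real n)\<^sup>2"
    by (simp add: qform_def uniform_weights_def comp_def len divide_inverse
        sum_list_mult_const sum_list_const_mult power2_eq_square mult.assoc mult.left_commute mult.commute)
  have "real n * (\<psi> \<one> - M \<psi> + 1) \<le> (real n)\<^sup>2 * e"
    using mult_left_mono[of "\<psi> \<one> - M \<psi> + 1" "n * e" n] n \<open>e > 0\<close>
    by (simp add: power2_eq_square pos_divide_less_eq mult.assoc)
  with le have "real n * (\<Sum>b\<leftarrow>bs. \<theta> b) + (\<Sum>a\<leftarrow>bs. \<Sum>b\<leftarrow>bs. \<psi> (inv a \<otimes> b))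
      \<le> (real n)\<^sup>2 * (M \<theta> + M \<psi> + e)"
    using assms(1) by (simp add: scale sum_list_const_mult power2_eq_square algebra_simps)
  then have "(real n * (\<Sum>b\<leftarrow>bs. \<theta> b) + (\<Sum>a\<leftarrow>bs. \<Sum>b\<leftarrow>bs. \<psi> (inv a \<otimes> b))) / (real n)\<^sup>2
      \<le> M \<theta> + M \<psi> + e"
    using n(1) by (simp add: pos_divide_le_eq mult.commute)
  then have "(\<Sum>b\<leftarrow>bs. \<theta> b) / n + qform \<psi> (uniform_weights bs) (uniform_weights bs) \<le> M \<theta> + M \<psi> + e"
    using n(1) by (simp add: q add_divide_distrib power2_eq_square)
  then show ?thesis
    using len bs n(1) by (intro exI[of _ bs]) auto
qed

text \<open>Let \<open>C\<close> be the total weight of \<open>xs\<close>. Adjoin points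
  \<open>bs\<close> of total weight \<open>- C\<close>, chosen so that the cross terms and the form
  of the new points together are at most their expected value, up to \<open>e\<close>. That value is
  \<open>- 2 * C\<^sup>2 * M \<phi> + C\<^sup>2 * M \<phi>\<close>, so nonnegativity of the enlarged
  form gives the claim. This plays the role of projecting away the invariant vectors.\<close>

lemma positive_definite_diff_mean:
  assumes "positive_definite \<phi>" "bdd \<phi>"
  shows "positive_definite (\<lambda>a. \<phi> a - M \<phi>)"
  unfolding positive_definite_def
proof (intro conjI ballI allI impI)
  have sym: "\<phi> (inv a) = \<phi> a" if "a \<in> carrier G" for a
    using assms that by (auto simp: positive_definite_def)
  then show "\<phi> (inv a) - M \<phi> = \<phi> a - M \<phi>" if "a \<in> carrier G" for a
    using that by simp
  fix xs :: "(real \<times> 'a) list" assume xs: "snd ` set xs \<subseteq> carrier G"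
  define C where "C = (\<Sum>(c, a)\<leftarrow>xs. c)"
  \<comment> \<open>Divided by \<open>length bs\<close>, this is the contribution of the point
    \<open>b\<close> to the cross terms between \<open>xs\<close> and the adjoined points.\<close>
  define \<theta> where "\<theta> b = (- 2 * C) * (\<Sum>(c, a)\<leftarrow>xs. c * \<phi> (inv a \<otimes> b))" for b
  have bs: "bdd (\<lambda>b. \<Sum>(c, a)\<leftarrow>xs. c * \<phi> (inv a \<otimes> b))"
    unfolding case_prod_unfold by (intro bdd_intros bdd_comp[OF assms(2)])
  then have b\<theta>: "bdd \<theta>"
    unfolding \<theta>_def by (intro bdd_mult bdd_const)
  have "M (\<lambda>b. \<Sum>p\<leftarrow>xs. fst p * \<phi> (inv (snd p) \<otimes> b)) = (\<Sum>p\<leftarrow>xs. M (\<lambda>b. fst p * \<phi> (inv (snd p) \<otimes> b)))"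
    by (intro sum_list bdd_intros bdd_comp[OF assms(2)])
  also have "\<dots> = (\<Sum>p\<leftarrow>xs. fst p * M \<phi>)"
    using xs by (intro arg_cong[of _ _ sum_list] map_cong refl)
      (auto simp: scale bdd_comp[OF assms(2)] translate[OF assms(2)])
  also have "\<dots> = C * M \<phi>"
    by (simp add: C_def sum_list_mult_const case_prod_unfold)
  finally have M\<theta>: "M \<theta> = - 2 * C\<^sup>2 * M \<phi>"
    unfolding \<theta>_def using bs by (subst scale) (simp_all add: case_prod_unfold power2_eq_square)
  have "0 \<le> qform \<phi> xs xs - C\<^sup>2 * M \<phi> + e" if e: "e > 0" for e
  proof -
    obtain bs where bs: "bs \<noteq> []" "set bs \<subseteq> carrier G" and
      le: "(\<Sum>b\<leftarrow>bs. \<theta> b) / length bs +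
        qform (\<lambda>b. C\<^sup>2 * \<phi> b) (uniform_weights bs) (uniform_weights bs)
          \<le> M \<theta> + M (\<lambda>b. C\<^sup>2 * \<phi> b) + e"
    proof -
      have "bdd (\<lambda>b. C\<^sup>2 * \<phi> b)"
        by (intro bdd_intros assms(2))
      from exists_small_average[OF b\<theta> this _ e] sym show ?thesis
        by (auto intro: that)
    qed
    define ys where "ys = map (Pair (- C / length bs)) bs"
    have ys: "snd ` set ys \<subseteq> carrier G"
      using bs by (auto simp: ys_def)
    have "qform \<phi> ys ys = qform (\<lambda>b. C\<^sup>2 * \<phi> b) (uniform_weights bs) (uniform_weights bs)"
      by (simp add: qform_def ys_def uniform_weights_def comp_def power2_eq_square algebra_simps)
    moreover have "2 * qform \<phi> ys xs = (\<Sum>b\<leftarrow>bs. \<theta> b) / length bs"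
    proof -
      have "2 * (\<Sum>(c, a)\<leftarrow>xs. - C / length bs * c * \<phi> (inv b \<otimes> a)) = 1 / length bs * \<theta> b"
        if b: "b \<in> set bs" for b
      proof -
        have "\<phi> (inv b \<otimes> a) = \<phi> (inv a \<otimes> b)" if "(c, a) \<in> set xs" for c a
        proof -
          have "a \<in> carrier G" "b \<in> carrier G"
            using that b xs bs by (auto simp: subset_iff image_iff)
          then show ?thesis
            using sym[of "inv a \<otimes> b"] by (simp add: inv_mult_group)
        qed
        then have "(\<Sum>(c, a)\<leftarrow>xs. - C / length bs * c * \<phi> (inv b \<otimes> a)) =
            (\<Sum>(c, a)\<leftarrow>xs. (- C / length bs) * (c * \<phi> (inv a \<otimes> b)))"
          by (intro arg_cong[of _ _ sum_list] map_cong) auto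
        also have "\<dots> = (- C / length bs) * (\<Sum>(c, a)\<leftarrow>xs. c * \<phi> (inv a \<otimes> b))"
          by (simp only: case_prod_unfold sum_list_const_mult)
        finally show ?thesis
          by (simp add: \<theta>_def)
      qed
      then have "(\<Sum>b\<leftarrow>bs. 2 * (\<Sum>(c, a)\<leftarrow>xs. - C / length bs * c * \<phi> (inv b \<otimes> a))) =
          (\<Sum>b\<leftarrow>bs. 1 / length bs * \<theta> b)"
        by (intro arg_cong[of _ _ sum_list] map_cong) auto
      then show ?thesis
        unfolding sum_list_const_mult by (simp add: qform_def ys_def comp_def)
    qed
    moreover have "0 \<le> qform \<phi> (xs @ ys) (xs @ ys)"
    proof -
      have "snd ` set (xs @ ys) \<subseteq> carrier G"
        using xs ys by auto
      then show ?thesis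
        using assms(1) unfolding positive_definite_def by blast
    qed
    ultimately show ?thesis
      using le qform_commute[of \<phi>, OF sym xs ys] unfolding qform_append M\<theta> scale[OF assms(2)]
      by linarith
  qed
  then have "0 \<le> qform \<phi> xs xs - C\<^sup>2 * M \<phi>"
    by (rule field_le_epsilon)
  then show "0 \<le> qform (\<lambda>a. \<phi> a - M \<phi>) xs xs"
    unfolding qform_diff_const C_def[symmetric] by (simp add: mult.commute)
qed

text \<open>The weights sum to 1, so the form of \<open>\<phi> - M \<phi>\<close> is the average
  minus \<open>M \<phi>\<close>. Together with \<open>exists_uniform_qform_le\<close> this
  identifies \<open>M \<phi>\<close> as the infimum of such averages.\<close>

lemma mean_le_qform:
  assumes "positive_definite \<phi>" "bdd \<phi>" "bs \<noteq> []" "set bs \<subseteq> carrier G"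
  shows "M \<phi> \<le> qform \<phi> (uniform_weights bs) (uniform_weights bs)"
proof -
  have "0 \<le> qform (\<lambda>a. \<phi> a - M \<phi>) (uniform_weights bs) (uniform_weights bs)"
    using positive_definite_diff_mean[OF assms(1,2)] assms(4)
    unfolding positive_definite_def by simp
  then show ?thesis
    using assms(3) by (simp add: qform_diff_const sum_uniform_weights)
qed

lemma exists_uniform_qform_le:
  assumes "bdd \<psi>" "\<And>a. a \<in> carrier G \<Longrightarrow> \<psi> (inv a) = \<psi> a" "e > 0"
  shows "\<exists>bs. bs \<noteq> [] \<and> set bs \<subseteq> carrier G \<and>
    qform \<psi> (uniform_weights bs) (uniform_weights bs) \<le> M \<psi> + e"
  using exists_small_average[of "\<lambda>_. 0" \<psi> e] assms by auto

text \<open>Uniform weights have total weight 1, and some of them bring the form within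
  \<open>e\<close> of the mean.\<close>

lemma le_mean_if_qform_ge:
  assumes "bdd \<psi>" "\<And>a. a \<in> carrier G \<Longrightarrow> \<psi> (inv a) = \<psi> a"
    and "\<And>xs. snd ` set xs \<subseteq> carrier G \<Longrightarrow> k * (\<Sum>(c, a)\<leftarrow>xs. c)\<^sup>2 \<le> qform \<psi> xs xs"
  shows "k \<le> M \<psi>"
proof (rule field_le_epsilon)
  fix e :: real assume "e > 0"
  then obtain bs where "bs \<noteq> []" "set bs \<subseteq> carrier G"
    "qform \<psi> (uniform_weights bs) (uniform_weights bs) \<le> M \<psi> + e"
    using exists_uniform_qform_le assms(1,2) by meson
  then show "k \<le> M \<psi> + e"
    using assms(3)[of "uniform_weights bs"] by (simp add: sum_uniform_weights)
qed

end

section \<open>Iterated means\<close>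

text \<open>Invariance under translating a single coordinate, phrased by function update so that the
  arguments below never mention the product group.\<close>

locale coordinate_mean = group G + mean "{1..d} \<rightarrow>\<^sub>E carrier G" N for G (structure) and d :: nat and N +
  assumes translate: "bdd f \<Longrightarrow> i \<in> {1..d} \<Longrightarrow> a \<in> carrier G \<Longrightarrow> N (\<lambda>h. f (h(i := a \<otimes> h i))) = N f"

locale iterated_mean = left_mean G M for G (structure) and M + fixes d :: nat
begin

abbreviation X where "X \<equiv> {1..d} \<rightarrow>\<^sub>E carrier G"

lemma update_in_X: "h \<in> X \<Longrightarrow> i \<in> {1..d} \<Longrightarrow> b \<in> carrier G \<Longrightarrow> h(i := b) \<in> X"
  by (auto simp: PiE_iff extensional_def)

definition cmean :: "nat \<Rightarrow> ((nat \<Rightarrow> 'a) \<Rightarrow> real) \<Rightarrow> (nat \<Rightarrow> 'a) \<Rightarrow> real" where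
  "cmean i K h = M (\<lambda>b. K (h(i := b)))"

definition pd_coord :: "nat \<Rightarrow> ((nat \<Rightarrow> 'a) \<Rightarrow> real) \<Rightarrow> bool" where
  "pd_coord i K \<longleftrightarrow> (\<forall>h\<in>X. positive_definite (\<lambda>b. K (h(i := b))))"

lemma bdd_cmean [bdd_intros]: "bdd K \<Longrightarrow> bdd (cmean i K)"
proof -
  assume "bdd K"
  then obtain C where C: "\<bar>K h\<bar> \<le> C" for h
    unfolding bdd_def by auto
  have "\<bar>cmean i K h\<bar> \<le> C" for h
    unfolding cmean_def by (rule abs_le) (rule C)
  then show "bdd (cmean i K)"
    unfolding bdd_def by blast
qed

text \<open>Means of positive definite functions are positive definite, and updates at distinct
  coordinates commute.\<close>

lemma pd_coord_cmean:
  assumes "bdd K" "pd_coord i K" "i \<noteq> j" "j \<in> {1..d}"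
  shows "pd_coord i (cmean j K)"
  unfolding pd_coord_def
proof
  fix h assume h: "h \<in> X"
  have "positive_definite (\<lambda>b. M (\<lambda>c. K (h(j := c, i := b))))"
    using assms h update_in_X
    by (intro positive_definite_mean[OF mean_axioms] bdd_comp[OF assms(1)]) (auto simp: pd_coord_def)
  then show "positive_definite (\<lambda>b. cmean j K (h(i := b)))"
    using assms(3) by (simp add: cmean_def fun_upd_twist)
qed

text \<open>The mean of a positive definite function is the infimum of its averages over finite
  configurations, hence upper semicontinuous.\<close>

lemma cmean_exchange:
  assumes "bdd K" "pd_coord i K" "i \<noteq> j" "i \<in> {1..d}" "j \<in> {1..d}" "h \<in> X"
  shows "cmean j (cmean i K) h \<le> cmean i (cmean j K) h"
proof (rule field_le_epsilon)
  fix e :: real assume "e > 0"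
  define \<psi> where "\<psi> b = cmean j K (h(i := b))" for b
  have bK: "bdd (\<lambda>c. K (f c))" for f :: "'a \<Rightarrow> nat \<Rightarrow> 'a"
    by (rule bdd_comp[OF assms(1)])
  have "bdd \<psi>"
    unfolding \<psi>_def by (rule bdd_comp[OF bdd_cmean[OF assms(1)]])
  moreover have "\<psi> (inv a) = \<psi> a" if "a \<in> carrier G" for a
    using pd_coord_cmean[OF assms(1,2,3,5)] assms(6) that
    unfolding pd_coord_def positive_definite_def \<psi>_def by blast
  \<comment> \<open>The points are nearly optimal for the function already averaged over coordinate
    \<open>j\<close>. The same points bound the inner mean from above for every \<open>c\<close>,
    and a finite form may be exchanged with \<open>M\<close>.\<close>
  ultimately obtain bs where bs: "bs \<noteq> []" "set bs \<subseteq> carrier G"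
    and le: "qform \<psi> (uniform_weights bs) (uniform_weights bs) \<le> M \<psi> + e"
    using exists_uniform_qform_le[of \<psi> e] \<open>e > 0\<close> by blast
  have "cmean j (cmean i K) h \<le>
      M (\<lambda>c. qform (\<lambda>b. K (h(j := c, i := b))) (uniform_weights bs) (uniform_weights bs))"
    unfolding cmean_def[of j "cmean i K"]
  proof (rule mono)
    show "bdd (\<lambda>c. cmean i K (h(j := c)))"
      by (rule bdd_comp[OF bdd_cmean[OF assms(1)]])
    show "bdd (\<lambda>c. qform (\<lambda>b. K (h(j := c, i := b))) (uniform_weights bs) (uniform_weights bs))"
      by (rule bdd_qform) (rule bK)
    fix c assume "c \<in> carrier G"
    then have "h(j := c) \<in> X"
      using assms(5,6) by (intro update_in_X)
    then have "positive_definite (\<lambda>b. K (h(j := c, i := b)))"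
      using assms(2) unfolding pd_coord_def by blast
    then show "cmean i K (h(j := c)) \<le>
        qform (\<lambda>b. K (h(j := c, i := b))) (uniform_weights bs) (uniform_weights bs)"
      unfolding cmean_def by (rule mean_le_qform[OF _ bK bs])
  qed
  also have "\<dots> = qform (\<lambda>b. M (\<lambda>c. K (h(j := c, i := b)))) (uniform_weights bs) (uniform_weights bs)"
    by (rule mean_qform[OF mean_axioms bK])
  also have "(\<lambda>b. M (\<lambda>c. K (h(j := c, i := b)))) = \<psi>"
    unfolding \<psi>_def[abs_def] cmean_def fun_upd_twist[OF assms(3)] ..
  finally show "cmean j (cmean i K) h \<le> cmean i (cmean j K) h + e"
    using le by (simp add: cmean_def[of i "cmean j K"] \<psi>_def[abs_def])
qed

section \<open>Averaging over the first \<open>n\<close> coordinates\<close>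

lemma cmean_mono:
  assumes "bdd K" "bdd K'" "\<And>h. h \<in> X \<Longrightarrow> K h \<le> K' h" "i \<in> {1..d}" "h \<in> X"
  shows "cmean i K h \<le> cmean i K' h"
  unfolding cmean_def
  by (intro mono bdd_comp[OF assms(1)] bdd_comp[OF assms(2)] assms(3) update_in_X assms(4,5))

text \<open>Coordinate \<open>Suc n\<close> is averaged first, hence innermost: in the notation of
  the introduction this is \<open>M\<^sub>1...M\<^sub>nK\<close>. The argument \<open>h\<close>
  supplies the coordinates that are not averaged.\<close>

fun itmean :: "nat \<Rightarrow> ((nat \<Rightarrow> 'a) \<Rightarrow> real) \<Rightarrow> (nat \<Rightarrow> 'a) \<Rightarrow> real" where
  "itmean 0 K = K"
| "itmean (Suc n) K = itmean n (cmean (Suc n) K)"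

lemma bdd_itmean [bdd_intros]: "bdd K \<Longrightarrow> bdd (itmean n K)"
  by (induction n arbitrary: K) (auto intro: bdd_cmean)

lemma itmean_mono:
  assumes "bdd K" "bdd K'" "\<And>h. h \<in> X \<Longrightarrow> K h \<le> K' h" "n \<le> d" "h \<in> X"
  shows "itmean n K h \<le> itmean n K' h"
  using assms
proof (induction n arbitrary: K K')
  case (Suc n)
  then show ?case
    by (auto intro!: Suc.IH bdd_cmean cmean_mono)
qed simp

lemma itmean_update:
  assumes "n < j"
  shows "itmean n (\<lambda>h. K (h(j := b))) h = itmean n K (h(j := b))"
  using assms
proof (induction n arbitrary: K)
  case (Suc n)
  have "cmean (Suc n) (\<lambda>h. K (h(j := b))) = (\<lambda>h. cmean (Suc n) K (h(j := b)))"
    using Suc.prems by (auto simp: cmean_def fun_upd_twist)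
  then show ?case
    unfolding itmean.simps using Suc.prems by (simp only:) (rule Suc.IH, simp)
qed simp

text \<open>The outermost mean, over coordinate \<open>j\<close>, moves inwards past the others by
  repeated use of \<open>cmean_exchange\<close>.\<close>

lemma cmean_itmean_le:
  assumes "bdd K" "\<And>i. i \<in> {1..n} \<Longrightarrow> pd_coord i K" "n < j" "j \<le> d" "h \<in> X"
  shows "cmean j (itmean n K) h \<le> itmean n (cmean j K) h"
  using assms
proof (induction n arbitrary: K)
  case (Suc n)
  have "cmean j (itmean n (cmean (Suc n) K)) h \<le> itmean n (cmean j (cmean (Suc n) K)) h"
    using Suc.prems by (intro Suc.IH bdd_cmean pd_coord_cmean) auto
  also have "\<dots> \<le> itmean n (cmean (Suc n) (cmean j K)) h"
    using Suc.prems by (intro itmean_mono bdd_cmean cmean_exchange) auto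
  finally show ?case by simp
qed simp

text \<open>Cauchy-Schwarz in the form \<open>square_le\<close>, one coordinate at a time.\<close>

lemma itmean_power2_ge:
  assumes "bdd K" "n \<le> d" "h \<in> X"
  shows "(itmean n K h)\<^sup>2 \<le> itmean n (\<lambda>h. (K h)\<^sup>2) h"
  using assms
proof (induction n arbitrary: K)
  case (Suc n)
  have "(itmean n (cmean (Suc n) K) h)\<^sup>2 \<le> itmean n (\<lambda>h. (cmean (Suc n) K h)\<^sup>2) h"
    using Suc.prems by (intro Suc.IH bdd_cmean) auto
  also have "\<dots> \<le> itmean n (cmean (Suc n) (\<lambda>h. (K h)\<^sup>2)) h"
    using Suc.prems unfolding cmean_def[of "Suc n" "\<lambda>h. (K h)\<^sup>2"]
    by (intro itmean_mono bdd_power bdd_cmean) 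
      (auto simp: cmean_def intro!: square_le bdd_comp[OF Suc.prems(1)] bdd_cmean[unfolded cmean_def] bdd_power)
  finally show ?case by simp
qed simp

lemma itmean_power_ge:
  assumes "bdd (K (Suc n))" and K: "\<And>h. h \<in> X \<Longrightarrow> (K n h)\<^sup>2 \<le> cmean (Suc n) (K (Suc n)) h"
    and "bdd (K n)" "Suc n \<le> d" "h \<in> X"
  shows "(itmean n (K n) h)\<^sup>2 \<le> itmean (Suc n) (K (Suc n)) h"
proof -
  have "(itmean n (K n) h)\<^sup>2 \<le> itmean n (\<lambda>h. (K n h)\<^sup>2) h"
    using assms by (intro itmean_power2_ge) auto
  also have "\<dots> \<le> itmean n (cmean (Suc n) (K (Suc n))) h"
    using assms by (intro itmean_mono bdd_power bdd_cmean) auto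
  finally show ?thesis by simp
qed

text \<open>A positive definite function minus its mean is positive definite. Testing it on averaging
  points together with the point \<open>h i\<close> of weight \<open>t\<close> gives a quadratic in \<open>t\<close> whose linear
  coefficient is \<open>2 * (N K - N (cmean i K))\<close> and whose constant term is at most any \<open>e > 0\<close>.\<close>

lemma mean_eq_cmean:
  assumes N: "coordinate_mean G d N" and bK: "bdd K" and i: "i \<in> {1..d}" and pd: "pd_coord i K"
    and le: "M (\<lambda>b. N (\<lambda>h. K (h(i := b)))) \<le> N (cmean i K)"
  shows "N K = N (cmean i K)"
proof -
  interpret N: coordinate_mean G d N by (rule N)
  obtain C where C: "\<bar>K h\<bar> \<le> C" for h
    using bK unfolding bdd_def by auto
  define w where "w = N (cmean i K)"
  define \<psi> where "\<psi> b = N (\<lambda>h. K (h(i := b)))" for b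
  have bK1: "bdd (\<lambda>x. K (f x))" for f :: "(nat \<Rightarrow> 'a) \<Rightarrow> nat \<Rightarrow> 'a"
    by (rule bdd_comp[OF bK])
  have bK2: "bdd (\<lambda>x. K (f x))" for f :: "'a \<Rightarrow> nat \<Rightarrow> 'a"
    by (rule bdd_comp[OF bK])
  have bc: "bdd (cmean i K)"
    by (rule bdd_cmean[OF bK])
  have b\<psi>: "bdd \<psi>"
  proof -
    have "\<bar>\<psi> b\<bar> \<le> C" for b
      unfolding \<psi>_def by (rule N.abs_le) (rule C)
    then show ?thesis unfolding bdd_def by blast
  qed
  have "positive_definite \<psi>"
    unfolding \<psi>_def using pd
    by (intro positive_definite_mean[OF N.mean_axioms] bK1) (auto simp: pd_coord_def)
  then have sym: "\<psi> (inv a) = \<psi> a" if "a \<in> carrier G" for a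
    using that unfolding positive_definite_def by blast
  have main: "0 \<le> t\<^sup>2 * (2 * C) + 2 * t * (N K - w) + e" if e: "e > 0" for t e
  proof -
    obtain bs where bs: "bs \<noteq> []" "set bs \<subseteq> carrier G"
      and q: "qform \<psi> (uniform_weights bs) (uniform_weights bs) \<le> M \<psi> + e"
      using exists_uniform_qform_le[OF b\<psi> sym e] by blast
    let ?ws = "uniform_weights bs"
    \<comment> \<open>\<open>t * L h\<close> is the cross term between the point \<open>h i\<close>
      and the averaging points; translation invariance of \<open>N\<close> in coordinate
      \<open>i\<close> will give \<open>N L = N K - w\<close>.\<close>
    define L where "L h = (\<Sum>b\<leftarrow>bs. 1 / length bs * (K (h(i := inv b \<otimes> h i)) - cmean i K h))" for h
    have bL: "bdd L"
      unfolding L_def by (intro bdd_intros bK1 bc)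
    have ineq: "0 \<le> t\<^sup>2 * (2 * C) + 2 * t * L h + (qform (\<lambda>b. K (h(i := b))) ?ws ?ws - cmean i K h)"
      if h: "h \<in> X" for h
    proof -
      define \<phi> where "\<phi> b = K (h(i := b)) - cmean i K h" for b
      have hi: "h i \<in> carrier G"
        using h i by auto
      have pd\<phi>: "positive_definite \<phi>"
        using positive_definite_diff_mean[of "\<lambda>b. K (h(i := b))", OF _ bK2] pd h
        unfolding \<phi>_def cmean_def pd_coord_def by blast
      have x: "snd ` set [(t, h i)] \<subseteq> carrier G" and ws: "snd ` set ?ws \<subseteq> carrier G"
        using hi bs by auto
      have "0 \<le> qform \<phi> ([(t, h i)] @ ?ws) ([(t, h i)] @ ?ws)"
      proof -
        have "snd ` set ([(t, h i)] @ ?ws) \<subseteq> carrier G"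
          using x ws unfolding set_append image_Un by blast
        then show ?thesis
          using pd\<phi> unfolding positive_definite_def by blast
      qed
      also have "\<dots> = qform \<phi> [(t, h i)] [(t, h i)] + 2 * qform \<phi> ?ws [(t, h i)] + qform \<phi> ?ws ?ws"
        using qform_commute[OF _ x ws, of \<phi>] pd\<phi> unfolding qform_append positive_definite_def by auto
      also have "qform \<phi> [(t, h i)] [(t, h i)] \<le> t\<^sup>2 * (2 * C)"
      proof -
        have "\<bar>cmean i K h\<bar> \<le> C"
          unfolding cmean_def by (rule abs_le) (rule C)
        then have "\<phi> \<one> \<le> 2 * C"
          using C[of "h(i := \<one>)"] by (simp add: \<phi>_def)
        then show ?thesis
          using hi by (simp add: qform_def power2_eq_square[symmetric] mult_left_mono)
      qed
      also have "qform \<phi> ?ws [(t, h i)] = t * L h"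
        by (simp add: qform_def uniform_weights_def L_def comp_def \<phi>_def sum_list_const_mult[symmetric] algebra_simps)
      also have "qform \<phi> ?ws ?ws = qform (\<lambda>b. K (h(i := b))) ?ws ?ws - cmean i K h"
        using bs(1) by (simp add: \<phi>_def[abs_def] qform_diff_const sum_uniform_weights)
      finally show ?thesis by simp
    qed
    have "0 \<le> N (\<lambda>h. t\<^sup>2 * (2 * C) + 2 * t * L h + (qform (\<lambda>b. K (h(i := b))) ?ws ?ws - cmean i K h))"
      by (intro N.ge_const ineq bdd_intros bL bdd_qform bK1 bc)
    also have "\<dots> = t\<^sup>2 * (2 * C) + 2 * t * N L + (N (\<lambda>h. qform (\<lambda>b. K (h(i := b))) ?ws ?ws) - w)"
      unfolding w_def
      by (simp add: N.add N.scale N.diff bdd_add bdd_mult bdd_diff bdd_const bL bc bK1 bdd_qform)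
    also have "N L = N K - w"
    proof -
      have "N L = (\<Sum>b\<leftarrow>bs. N (\<lambda>h. 1 / length bs * (K (h(i := inv b \<otimes> h i)) - cmean i K h)))"
        unfolding L_def by (intro N.sum_list bdd_intros bK1 bc)
      also have "\<dots> = (\<Sum>b\<leftarrow>bs. 1 / length bs * (N K - w))"
      proof (intro arg_cong[of _ _ sum_list] map_cong refl)
        fix b assume "b \<in> set bs"
        then have "inv b \<in> carrier G"
          using bs by auto
        then have "N (\<lambda>h. K (h(i := inv b \<otimes> h i))) = N K"
          by (rule N.translate[OF bK i])
        then show "N (\<lambda>h. 1 / length bs * (K (h(i := inv b \<otimes> h i)) - cmean i K h)) = 1 / length bs * (N K - w)"
          by (subst N.scale) (auto simp: N.diff bK1 bc w_def bdd_diff)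
      qed
      also have "\<dots> = N K - w"
        using bs(1) by (simp add: sum_list_triv)
      finally show ?thesis .
    qed
    also have "N (\<lambda>h. qform (\<lambda>b. K (h(i := b))) ?ws ?ws) = qform \<psi> ?ws ?ws"
      unfolding \<psi>_def by (rule mean_qform[OF N.mean_axioms bK1])
    \<comment> \<open>The hypothesis \<open>le\<close> enters here: the constant term is at most
      \<open>M \<psi> + e - w\<close>, hence at most \<open>e\<close>.\<close>
    finally show ?thesis
      using q le unfolding \<psi>_def[symmetric] w_def[symmetric] by linarith
  qed
  define D where "D = N K - w"
  have ge: "0 \<le> t\<^sup>2 * (2 * C) + 2 * t * D" for t
  proof (rule field_le_epsilon)
    fix e :: real assume "e > 0"
    then show "0 \<le> t\<^sup>2 * (2 * C) + 2 * t * D + e"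
      unfolding D_def by (rule main)
  qed
  have "C \<ge> 0"
    using C[of undefined] by linarith
  have "D = 0"
  proof (rule ccontr)
    assume "D \<noteq> 0"
    \<comment> \<open>At \<open>t = - x\<close> the quadratic is negative. The denominator
      \<open>2 * C + 1\<close> is positive even when \<open>C = 0\<close>.\<close>
    define x where "x = D / (2 * C + 1)"
    have D: "D = x * (2 * C + 1)"
      using \<open>C \<ge> 0\<close> by (simp add: x_def)
    have "0 \<le> (- x)\<^sup>2 * (2 * C) + 2 * (- x) * D"
      by (rule ge)
    also have "\<dots> = - (x\<^sup>2 * (2 * C + 2))"
      by (simp add: D algebra_simps power2_eq_square)
    also have "\<dots> < 0"
      using \<open>C \<ge> 0\<close> \<open>D \<noteq> 0\<close> D by auto
    finally show False by simp
  qed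
  then show ?thesis
    by (simp add: D_def w_def)
qed

text \<open>Induction on the number of coordinates that \<open>K\<close> depends on; with none left,
  \<open>K\<close> is constant on \<open>X\<close>. The induction hypothesis is used twice: for
  \<open>cmean (Suc n) K\<close>, and for each slice with coordinate \<open>Suc n\<close> frozen at
  \<open>b\<close>. Averaging the slices over \<open>b\<close> and applying
  \<open>cmean_itmean_le\<close> yields the inequality that \<open>mean_eq_cmean\<close>
  requires.\<close>

lemma mean_eq_itmean:
  assumes N: "coordinate_mean G d N" and "bdd K" "n \<le> d"
    and "\<And>i. i \<in> {1..n} \<Longrightarrow> pd_coord i K"
    and "\<And>h h'. h \<in> X \<Longrightarrow> h' \<in> X \<Longrightarrow> (\<And>i. i \<in> {1..n} \<Longrightarrow> h i = h' i) \<Longrightarrow> K h = K h'"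
    and h0: "h0 \<in> X"
  shows "N K = itmean n K h0"
  using assms(2-5)
proof (induction n arbitrary: K)
  case 0
  interpret N: coordinate_mean G d N by (rule N)
  have "N K = N (\<lambda>_. K h0)"
  proof (rule N.cong)
    show "K h = K h0" if "h \<in> X" for h
      using that h0 by (rule 0) simp
  qed (use 0 in simp_all)
  then show ?case by simp
next
  case (Suc n)
  note dep = Suc.prems(4)
  have n: "Suc n \<in> {1..d}"
    using Suc.prems by auto
  have c: "N (cmean (Suc n) K) = itmean (Suc n) K h0"
    unfolding itmean.simps
  proof (rule Suc.IH)
    show "pd_coord i (cmean (Suc n) K)" if "i \<in> {1..n}" for i
      using Suc.prems that n by (intro pd_coord_cmean) auto
    show "cmean (Suc n) K h = cmean (Suc n) K h'"
      if "h \<in> X" "h' \<in> X" "\<And>i. i \<in> {1..n} \<Longrightarrow> h i = h' i" for h h'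
      unfolding cmean_def
    proof (rule cong)
      fix b assume "b \<in> carrier G"
      then show "K (h(Suc n := b)) = K (h'(Suc n := b))"
        using that n by (intro dep update_in_X) auto
    qed (rule bdd_comp[OF Suc.prems(1)])+
  qed (use Suc.prems in \<open>auto intro: bdd_cmean\<close>)
  have "N (\<lambda>h. K (h(Suc n := b))) = itmean n K (h0(Suc n := b))" if b: "b \<in> carrier G" for b
  proof -
    have "N (\<lambda>h. K (h(Suc n := b))) = itmean n (\<lambda>h. K (h(Suc n := b))) h0"
    proof (rule Suc.IH)
      show "bdd (\<lambda>h. K (h(Suc n := b)))"
        by (rule bdd_comp[OF Suc.prems(1)])
      show "pd_coord i (\<lambda>h. K (h(Suc n := b)))" if "i \<in> {1..n}" for i
        unfolding pd_coord_def
      proof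
        fix h assume "h \<in> X"
        then have "positive_definite (\<lambda>c. K (h(Suc n := b, i := c)))"
          using Suc.prems(3)[of i] that update_in_X[OF _ n b] by (auto simp: pd_coord_def)
        then show "positive_definite (\<lambda>c. K (h(i := c, Suc n := b)))"
          using that by (simp add: fun_upd_twist)
      qed
      show "K (h(Suc n := b)) = K (h'(Suc n := b))"
        if "h \<in> X" "h' \<in> X" "\<And>i. i \<in> {1..n} \<Longrightarrow> h i = h' i" for h h'
        using that n b by (intro dep update_in_X) auto
    qed (use Suc.prems in auto)
    then show ?thesis
      by (simp add: itmean_update)
  qed
  then have "M (\<lambda>b. N (\<lambda>h. K (h(Suc n := b)))) = cmean (Suc n) (itmean n K) h0"
    unfolding cmean_def
  proof (intro cong)
    obtain C where C: "\<bar>K h\<bar> \<le> C" for h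
      using Suc.prems(1) unfolding bdd_def by auto
    interpret N: coordinate_mean G d N by (rule N)
    have "\<bar>N (\<lambda>h. K (h(Suc n := b)))\<bar> \<le> C" for b
      by (rule N.abs_le) (rule C)
    then show "bdd (\<lambda>b. N (\<lambda>h. K (h(Suc n := b))))"
      unfolding bdd_def by blast
    show "bdd (\<lambda>b. itmean n K (h0(Suc n := b)))"
      by (rule bdd_comp[OF bdd_itmean[OF Suc.prems(1)]])
  qed auto
  also have "\<dots> \<le> itmean n (cmean (Suc n) K) h0"
    using Suc.prems h0 by (intro cmean_itmean_le) auto
  finally have "N K = N (cmean (Suc n) K)"
    using Suc.prems n c by (intro mean_eq_cmean[OF N]) auto
  with c show ?case by simp
qed

end

section \<open>Corner configurations\<close>

context coordinate_mean
begin

text \<open>For the indicator of a set \<open>B\<close> this is the mean of the intersection of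
  \<open>B\<close> with its translate by \<open>b\<close> in coordinate \<open>i\<close>.\<close>

definition autocorr :: "((nat \<Rightarrow> 'a) \<Rightarrow> real) \<Rightarrow> nat \<Rightarrow> 'a \<Rightarrow> real" where
  "autocorr \<beta> i b = N (\<lambda>g. \<beta> g * \<beta> (g(i := inv b \<otimes> g i)))"

lemma bdd_autocorr: "bdd \<beta> \<Longrightarrow> bdd (autocorr \<beta> i)"
proof -
  assume "bdd \<beta>"
  then obtain C where C: "\<bar>\<beta> g\<bar> \<le> C" for g
    unfolding bdd_def by auto
  have "\<bar>\<beta> g * \<beta> g'\<bar> \<le> C * C" for g g'
    unfolding abs_mult using C[of g] C[of g'] by (intro mult_mono) auto
  then have "\<bar>autocorr \<beta> i b\<bar> \<le> C * C" for b
    unfolding autocorr_def by (intro abs_le)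
  then show ?thesis
    unfolding bdd_def by blast
qed

lemma autocorr_eq:
  assumes "bdd \<beta>" "i \<in> {1..d}" "a \<in> carrier G" "b \<in> carrier G"
  shows "autocorr \<beta> i (inv a \<otimes> b) = N (\<lambda>g. \<beta> (g(i := inv a \<otimes> g i)) * \<beta> (g(i := inv b \<otimes> g i)))"
proof -
  define f where "f g = \<beta> g * \<beta> (g(i := inv (inv a \<otimes> b) \<otimes> g i))" for g
  have b: "bdd f"
    unfolding f_def by (intro bdd_mult bdd_comp[OF assms(1)])
  have "autocorr \<beta> i (inv a \<otimes> b) = N (\<lambda>g. f (g(i := inv a \<otimes> g i)))"
    using translate[OF b assms(2), of "inv a"] assms(3) by (simp add: autocorr_def f_def[abs_def])
  also have "\<dots> = N (\<lambda>g. \<beta> (g(i := inv a \<otimes> g i)) * \<beta> (g(i := inv b \<otimes> g i)))"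
  proof (rule cong)
    fix g assume "g \<in> {1..d} \<rightarrow>\<^sub>E carrier G"
    then have "g i \<in> carrier G"
      using assms(2) by auto
    then have "inv (inv a \<otimes> b) \<otimes> (inv a \<otimes> g i) = inv b \<otimes> g i"
      using assms(3,4) by (simp add: inv_mult_group m_assoc) (simp add: m_assoc[symmetric])
    then show "f (g(i := inv a \<otimes> g i)) = \<beta> (g(i := inv a \<otimes> g i)) * \<beta> (g(i := inv b \<otimes> g i))"
      by (simp add: f_def)
  qed (intro bdd_mult bdd_comp[OF b] bdd_comp[OF assms(1)])+
  finally show ?thesis .
qed

lemma autocorr_inv:
  assumes "bdd \<beta>" "i \<in> {1..d}" "a \<in> carrier G"
  shows "autocorr \<beta> i (inv a) = autocorr \<beta> i a"
  using autocorr_eq[OF assms one_closed] autocorr_eq[OF assms(1,2) one_closed assms(3)] assms(3)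
  by (simp add: mult.commute)

text \<open>The form is the mean of the square of a weighted sum of translates of
  \<open>\<beta>\<close>, so \<open>square_le\<close> and invariance apply. The bound gives positive
  definiteness and also, through \<open>le_mean_if_qform_ge\<close>, a lower bound for the mean
  autocorrelation.\<close>

lemma qform_autocorr_ge:
  assumes "bdd \<beta>" "i \<in> {1..d}" "snd ` set xs \<subseteq> carrier G"
  shows "(N \<beta>)\<^sup>2 * (\<Sum>(c, a)\<leftarrow>xs. c)\<^sup>2 \<le> qform (autocorr \<beta> i) xs xs"
proof -
  define u where "u p g = fst p * \<beta> (g(i := inv (snd p) \<otimes> g i))" for p g
  have bu: "bdd (u p)" for p
    unfolding u_def by (intro bdd_mult bdd_const bdd_comp[OF assms(1)])
  have "fst p * fst q * autocorr \<beta> i (inv (snd p) \<otimes> snd q) = N (\<lambda>g. u p g * u q g)"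
    if "p \<in> set xs" "q \<in> set xs" for p q
  proof -
    have "snd p \<in> carrier G" "snd q \<in> carrier G"
      using that assms(3) by auto
    then have "fst p * fst q * autocorr \<beta> i (inv (snd p) \<otimes> snd q) =
        N (\<lambda>g. fst p * fst q * (\<beta> (g(i := inv (snd p) \<otimes> g i)) * \<beta> (g(i := inv (snd q) \<otimes> g i))))"
      by (subst scale) (auto intro: bdd_mult bdd_comp[OF assms(1)] simp: autocorr_eq[OF assms(1,2)])
    then show ?thesis
      by (simp add: u_def mult_ac)
  qed
  then have "qform (autocorr \<beta> i) xs xs = (\<Sum>p\<leftarrow>xs. \<Sum>q\<leftarrow>xs. N (\<lambda>g. u p g * u q g))"
    unfolding qform_def case_prod_unfold
    by (intro arg_cong[of _ _ sum_list] map_cong refl) auto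
  also have "\<dots> = N (\<lambda>g. \<Sum>p\<leftarrow>xs. \<Sum>q\<leftarrow>xs. u p g * u q g)"
    by (simp add: sum_list bdd_sum_list bdd_mult bu)
  also have "\<dots> = N (\<lambda>g. (\<Sum>p\<leftarrow>xs. u p g)\<^sup>2)"
    by (simp add: sum_list_const_mult sum_list_mult_const power2_eq_square)
  also have "\<dots> \<ge> (N (\<lambda>g. \<Sum>p\<leftarrow>xs. u p g))\<^sup>2"
    by (intro square_le bdd_sum_list bu)
  also have "N (\<lambda>g. \<Sum>p\<leftarrow>xs. u p g) = (\<Sum>p\<leftarrow>xs. N (u p))"
    by (intro sum_list bu)
  also have "\<dots> = (\<Sum>p\<leftarrow>xs. fst p * N \<beta>)"
    using assms(3) unfolding u_def
    by (intro arg_cong[of _ _ sum_list] map_cong refl)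
      (auto simp: scale bdd_comp[OF assms(1)] translate[OF assms(1,2)])
  also have "\<dots> = (\<Sum>(c, a)\<leftarrow>xs. c) * N \<beta>"
    by (simp add: sum_list_mult_const case_prod_unfold)
  finally show ?thesis
    by (simp add: power_mult_distrib mult.commute)
qed

lemma positive_definite_autocorr:
  assumes "bdd \<beta>" "i \<in> {1..d}"
  shows "positive_definite (autocorr \<beta> i)"
  unfolding positive_definite_def
proof (intro conjI ballI allI impI)
  fix xs :: "(real \<times> 'a) list" assume "snd ` set xs \<subseteq> carrier G"
  from qform_autocorr_ge[OF assms this] show "0 \<le> qform (autocorr \<beta> i) xs xs"
    by (rule order_trans[rotated]) simp
qed (rule autocorr_inv[OF assms])

end

text \<open>One vertex of the cube \<open>h.g\<close>; the exponent vector is encoded by the set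
  \<open>J\<close> of coordinates where it is 1.\<close>

definition (in group) shift :: "nat set \<Rightarrow> (nat \<Rightarrow> 'a) \<Rightarrow> (nat \<Rightarrow> 'a) \<Rightarrow> nat \<Rightarrow> 'a" where
  "shift J h g = (\<lambda>i. if i \<in> J then inv (h i) \<otimes> g i else g i)"

text \<open>For \<open>S = {1..d}\<close> this is the function \<open>K\<close> of the introduction;
  smaller \<open>S\<close> serve the induction on coordinates.\<close>

definition (in coordinate_mean) corner_mean :: "(nat \<Rightarrow> 'a) set \<Rightarrow> nat set \<Rightarrow> (nat \<Rightarrow> 'a) \<Rightarrow> real" where
  "corner_mean E S h = N (\<lambda>g. of_bool (\<forall>J\<subseteq>S. shift J h g \<in> E))"

context coordinate_mean
begin

lemma bdd_corner_mean: "bdd (corner_mean E S)"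
proof -
  have "\<bar>corner_mean E S h\<bar> \<le> 1" for h
    unfolding corner_mean_def by (rule abs_le) simp
  then show ?thesis
    unfolding bdd_def by blast
qed

text \<open>The cube in the directions \<open>insert i S\<close> consists of the cube in the
  directions \<open>S\<close> and its translate by \<open>inv b\<close> in coordinate
  \<open>i\<close>.\<close>

lemma corner_mean_insert:
  assumes "i \<notin> S"
  shows "corner_mean E (insert i S) (h(i := b)) =
    autocorr (\<lambda>g. of_bool (\<forall>J\<subseteq>S. shift J h g \<in> E)) i b"
proof -
  have all: "(\<forall>J\<subseteq>insert i S. P J) \<longleftrightarrow> (\<forall>J\<subseteq>S. P J) \<and> (\<forall>J\<subseteq>S. P (insert i J))" for P
    by (metis insert_mono subset_insert subset_insertI2 subset_insert_iff insert_Diff)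
  have "shift (insert i J) (h(i := b)) g = shift J h (g(i := inv b \<otimes> g i))"
    "shift J (h(i := b)) g = shift J h g" if "J \<subseteq> S" for J g
    using that assms by (auto simp: shift_def fun_eq_iff)
  then have "(\<forall>J\<subseteq>insert i S. shift J (h(i := b)) g \<in> E) \<longleftrightarrow>
      (\<forall>J\<subseteq>S. shift J h g \<in> E) \<and> (\<forall>J\<subseteq>S. shift J h (g(i := inv b \<otimes> g i)) \<in> E)" for g
    unfolding all by auto
  then show ?thesis
    by (simp add: corner_mean_def autocorr_def of_bool_conj)
qed

lemma corner_mean_cong: "(\<And>i. i \<in> S \<Longrightarrow> h i = h' i) \<Longrightarrow> corner_mean E S h = corner_mean E S h'"
proof -
  assume "\<And>i. i \<in> S \<Longrightarrow> h i = h' i"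
  then have "shift J h g = shift J h' g" if "J \<subseteq> S" for J g
    using that by (auto simp: shift_def fun_eq_iff)
  then show ?thesis
    unfolding corner_mean_def by simp
qed

end

section \<open>Lower bounds for means of corner configurations\<close>

context iterated_mean
begin

lemma pd_coord_corner_mean:
  assumes "coordinate_mean G d N" "i \<in> S" "i \<in> {1..d}"
  shows "pd_coord i (coordinate_mean.corner_mean G N E S)"
proof -
  interpret N: coordinate_mean G d N by (rule assms(1))
  have "insert i (S - {i}) = S"
    using assms(2) by auto
  then have "(\<lambda>b. N.corner_mean E S (h(i := b))) =
      N.autocorr (\<lambda>g. of_bool (\<forall>J\<subseteq>S - {i}. shift J h g \<in> E)) i" for h
    using N.corner_mean_insert[of i "S - {i}" E h] by auto
  then show ?thesis
    unfolding pd_coord_def using N.positive_definite_autocorr[OF bdd_of_bool assms(3)] by simp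
qed

text \<open>The mean autocorrelation of an indicator is at least the square of its mean; here the
  indicator is that of the corners in the directions \<open>S\<close>.\<close>

lemma corner_mean_power2_le:
  assumes "coordinate_mean G d N" "i \<notin> S" "i \<in> {1..d}"
  shows "(coordinate_mean.corner_mean G N E S h)\<^sup>2 \<le> cmean i (coordinate_mean.corner_mean G N E (insert i S)) h"
proof -
  interpret N: coordinate_mean G d N by (rule assms(1))
  show ?thesis
    unfolding cmean_def N.corner_mean_insert[OF assms(2)] N.corner_mean_def[of E S h]
    by (intro le_mean_if_qform_ge N.bdd_autocorr N.autocorr_inv N.qform_autocorr_ge bdd_of_bool assms(3))
qed

text \<open>Each new coordinate squares the lower bound, which produces the exponent
  \<open>2 ^ n\<close>.\<close>

lemma itmean_corner_mean_ge:
  assumes "coordinate_mean G d N" "n \<le> d" "h \<in> X"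
  shows "N (\<lambda>g. of_bool (g \<in> E)) ^ 2 ^ n \<le> itmean n (coordinate_mean.corner_mean G N E {1..n}) h"
  using assms(2)
proof (induction n)
  interpret N: coordinate_mean G d N by (rule assms(1))
  case 0
  then show ?case
    by (simp add: N.corner_mean_def shift_def)
next
  interpret N: coordinate_mean G d N by (rule assms(1))
  case (Suc n)
  have "0 \<le> N (\<lambda>g. of_bool (g \<in> E))"
    by (intro N.ge_const bdd_of_bool) simp
  then have "N (\<lambda>g. of_bool (g \<in> E)) ^ 2 ^ Suc n \<le> (itmean n (N.corner_mean E {1..n}) h)\<^sup>2"
    using Suc by (simp add: power_mult mult.commute[of 2] power_mono)
  also have "\<dots> \<le> itmean (Suc n) (N.corner_mean E {1..Suc n}) h"
  proof (rule itmean_power_ge[where K = "\<lambda>n. N.corner_mean E {1..n}"])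
    show "(N.corner_mean E {1..n} h)\<^sup>2 \<le> cmean (Suc n) (N.corner_mean E {1..Suc n}) h" for h
      using corner_mean_power2_le[OF assms(1), of "Suc n" "{1..n}"] Suc.prems
      by (simp add: atLeastAtMostSuc_conv)
  qed (use Suc.prems assms(3) N.bdd_corner_mean in auto)
  finally show ?case .
qed

text \<open>\<open>N\<close> measures the base points \<open>g\<close> and \<open>N'\<close>
  averages over the directions \<open>h\<close>; the two means may be different.\<close>

lemma mean_corner_mean_ge:
  assumes "coordinate_mean G d N" "coordinate_mean G d N'"
  shows "N (\<lambda>g. of_bool (g \<in> E)) ^ 2 ^ d \<le> N' (coordinate_mean.corner_mean G N E {1..d})"
proof -
  interpret N: coordinate_mean G d N by (rule assms(1))
  define h where "h = (\<lambda>i\<in>{1..d}. \<one>)"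
  have h: "h \<in> X"
    by (simp add: h_def)
  have "N' (N.corner_mean E {1..d}) = itmean d (N.corner_mean E {1..d}) h"
  proof (rule mean_eq_itmean[OF assms(2) N.bdd_corner_mean order_refl _ _ h])
    show "pd_coord i (N.corner_mean E {1..d})" if "i \<in> {1..d}" for i
      using assms(1) that that by (rule pd_coord_corner_mean)
    show "N.corner_mean E {1..d} h = N.corner_mean E {1..d} h'"
      if "\<And>i. i \<in> {1..d} \<Longrightarrow> h i = h' i" for h h'
      using that by (rule N.corner_mean_cong)
  qed
  with itmean_corner_mean_ge[OF assms(1) order_refl h] show ?thesis
    by simp
qed

end

section \<open>Densities and syndetic sets\<close>

lemma left_Folner_seq_subseq:
  assumes "left_Folner_seq H \<Psi>" "filterlim r at_top sequentially"
  shows "left_Folner_seq H (\<lambda>N. \<Psi> (r N))"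
  using assms unfolding left_Folner_seq_def
  by (auto intro: filterlim_compose[OF _ assms(2)])

lemma (in group) l_coset_r_coset_commute:
  assumes "g \<in> carrier G" "x \<in> carrier G" "A \<subseteq> carrier G"
  shows "g <# (A #> x) = (g <# A) #> x"
  using assms by (auto simp: l_coset_def r_coset_def m_assoc subset_iff)

text \<open>Right translations commute with left ones and preserve cardinality, so every ratio is
  unchanged, even with a different translation for each \<open>N\<close>.\<close>

lemma (in group) left_Folner_seq_translate:
  assumes \<Psi>: "left_Folner_seq G \<Psi>" and x: "\<And>N. x N \<in> carrier G"
  shows "left_Folner_seq G (\<lambda>N. \<Psi> N #> x N)"
proof -
  have sub: "\<Psi> N \<subseteq> carrier G" for N
    using \<Psi> by (auto simp: left_Folner_seq_def)
  have im: "A #> x N = (\<lambda>a. a \<otimes> x N) ` A" for A N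
    by (auto simp: r_coset_def)
  have inj: "inj_on (\<lambda>a. a \<otimes> x N) (carrier G)" for N
    using inj_on_multc[OF x] .
  have card: "card (A #> x N) = card A" if "A \<subseteq> carrier G" for A N
    unfolding im using card_image[OF inj_on_subset[OF inj that]] .
  have "(\<Psi> N #> x N) \<inter> (g <# (\<Psi> N #> x N)) = (\<Psi> N \<inter> (g <# \<Psi> N)) #> x N" if "g \<in> carrier G" for g N
  proof -
    have "g <# \<Psi> N \<subseteq> carrier G"
      using l_coset_subset_G[OF sub that] .
    then show ?thesis
      unfolding l_coset_r_coset_commute[OF that x sub] unfolding im
      using inj_on_image_Int[OF inj sub] by metis
  qed
  moreover have "\<Psi> N \<inter> A \<subseteq> carrier G" for A N
    using sub[of N] by auto
  ultimately have "card ((\<Psi> N #> x N) \<inter> (g <# (\<Psi> N #> x N))) = card (\<Psi> N \<inter> (g <# \<Psi> N))"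
    if "g \<in> carrier G" for g N
    using that by (simp add: card)
  moreover have "finite (\<Psi> N #> x N)" "\<Psi> N #> x N \<noteq> {}" for N
    using \<Psi> by (auto simp: left_Folner_seq_def im)
  ultimately show ?thesis
    using \<Psi> r_coset_subset_G[OF sub x] by (auto simp: left_Folner_seq_def card[OF sub])
qed

text \<open>If \<open>S\<close> is not left-syndetic, its complement contains right translates of all
  sets of a Folner sequence, and these translates form a Folner sequence again.\<close>

lemma left_syndeticI_mean:
  assumes G: "group H" and \<Psi>: "left_Folner_seq H \<Psi>" and S: "S \<subseteq> carrier H"
    and pos: "\<And>m. left_mean H m \<Longrightarrow> 0 < m (\<lambda>x. of_bool (x \<in> S))"
  shows "left_syndetic H S"
proof (rule ccontr)
  interpret group H by (rule G)
  assume not: "\<not> left_syndetic H S"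
  have \<Psi>N: "finite (\<Psi> N)" "\<Psi> N \<subseteq> carrier H" for N
    using \<Psi> by (auto simp: left_Folner_seq_def)
  have "\<exists>x\<in>carrier H. (\<Psi> N #>\<^bsub>H\<^esub> x) \<inter> S = {}" for N
  proof -
    \<comment> \<open>A point \<open>x\<close> outside all translates of \<open>S\<close> by
      inverses of elements \<open>a\<close> of \<open>\<Psi> N\<close> has no product
      \<open>a \<otimes> x\<close> in \<open>S\<close>.\<close>
    let ?F = "m_inv H ` \<Psi> N"
    have F: "finite ?F" "?F \<subseteq> carrier H"
      using \<Psi>N[of N] by auto
    have "(\<Union>g\<in>?F. g <#\<^bsub>H\<^esub> S) \<subseteq> carrier H"
      using F(2) l_coset_subset_G[OF S] by blast
    moreover have "carrier H \<noteq> (\<Union>g\<in>?F. g <#\<^bsub>H\<^esub> S)"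
    proof
      assume "carrier H = (\<Union>g\<in>?F. g <#\<^bsub>H\<^esub> S)"
      with F S have "left_syndetic H S"
        unfolding left_syndetic_def by (intro conjI exI[of _ ?F])
      with not show False by simp
    qed
    ultimately obtain x where x: "x \<in> carrier H" "\<And>g. g \<in> ?F \<Longrightarrow> x \<notin> g <#\<^bsub>H\<^esub> S"
      by blast
    have "a \<otimes>\<^bsub>H\<^esub> x \<notin> S" if a: "a \<in> \<Psi> N" for a
    proof
      assume "a \<otimes>\<^bsub>H\<^esub> x \<in> S"
      moreover have "a \<in> carrier H"
        using a \<Psi>N by blast
      then have "x = inv\<^bsub>H\<^esub> a \<otimes>\<^bsub>H\<^esub> (a \<otimes>\<^bsub>H\<^esub> x)"
        using x(1) by (simp add: m_assoc[symmetric])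
      ultimately have "x \<in> inv\<^bsub>H\<^esub> a <#\<^bsub>H\<^esub> S"
        unfolding l_coset_def by blast
      with x(2)[of "inv\<^bsub>H\<^esub> a"] a show False by blast
    qed
    with x(1) show ?thesis
      by (auto simp: r_coset_def)
  qed
  then obtain x where x: "\<And>N. x N \<in> carrier H" "\<And>N. (\<Psi> N #>\<^bsub>H\<^esub> x N) \<inter> S = {}"
    by metis
  obtain m where m: "left_mean H m" and
    le: "\<And>f L. bdd f \<Longrightarrow> eventually (\<lambda>N. sum f (\<Psi> N #>\<^bsub>H\<^esub> x N) / card (\<Psi> N #>\<^bsub>H\<^esub> x N) \<le> L) sequentially
      \<Longrightarrow> m f \<le> L"
    using exists_Folner_mean[OF G left_Folner_seq_translate[OF \<Psi>, of x, OF x(1)]]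
    by (elim exE conjE) (rule that, assumption, simp only: simp_thms)
  have "sum (\<lambda>y. of_bool (y \<in> S) :: real) (\<Psi> N #>\<^bsub>H\<^esub> x N) = 0" for N
    using x(2)[of N] by (intro sum.neutral) auto
  then have "m (\<lambda>y. of_bool (y \<in> S)) \<le> 0"
    by (intro le bdd_of_bool) simp
  with pos[OF m] show False by simp
qed

lemma left_syndetic_mono:
  assumes "group H" "left_syndetic H S" "S \<subseteq> T" "T \<subseteq> carrier H"
  shows "left_syndetic H T"
proof -
  interpret group H by (rule assms(1))
  obtain F where F: "finite F" "F \<subseteq> carrier H" "carrier H = (\<Union>g\<in>F. g <#\<^bsub>H\<^esub> S)"
    using assms(2) unfolding left_syndetic_def by blast
  have "g <#\<^bsub>H\<^esub> S \<subseteq> g <#\<^bsub>H\<^esub> T" for g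
    using assms(3) by (auto simp: l_coset_def)
  then have "carrier H \<subseteq> (\<Union>g\<in>F. g <#\<^bsub>H\<^esub> T)"
    unfolding F(3) by (rule UN_mono[OF order_refl])
  moreover have "(\<Union>g\<in>F. g <#\<^bsub>H\<^esub> T) \<subseteq> carrier H"
    using F(2) assms(4) l_coset_subset_G by blast
  ultimately show ?thesis
    using F(1,2) assms(4) unfolding left_syndetic_def by blast
qed

text \<open>Inversion turns a cover by the sets \<open>g S\<close> into one by the inverse of
  \<open>S\<close> multiplied on the right by \<open>inv g\<close>.\<close>

lemma right_syndetic_inverse:
  assumes "group H" "left_syndetic H S"
    and T: "T \<subseteq> carrier H" "\<And>x. x \<in> S \<Longrightarrow> inv\<^bsub>H\<^esub> x \<in> T"
  shows "right_syndetic H T"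
proof -
  interpret group H by (rule assms(1))
  obtain F where F: "finite F" "F \<subseteq> carrier H" "carrier H = (\<Union>g\<in>F. g <#\<^bsub>H\<^esub> S)"
    and S: "S \<subseteq> carrier H"
    using assms(2) unfolding left_syndetic_def by blast
  have "carrier H = (\<Union>g\<in>m_inv H ` F. T #>\<^bsub>H\<^esub> g)"
  proof
    show "(\<Union>g\<in>m_inv H ` F. T #>\<^bsub>H\<^esub> g) \<subseteq> carrier H"
      using F(2) T(1) r_coset_subset_G by blast
    show "carrier H \<subseteq> (\<Union>g\<in>m_inv H ` F. T #>\<^bsub>H\<^esub> g)"
    proof
      fix y assume y: "y \<in> carrier H"
      then have "inv\<^bsub>H\<^esub> y \<in> (\<Union>g\<in>F. g <#\<^bsub>H\<^esub> S)"
        by (intro F(3)[THEN equalityD1, THEN subsetD] inv_closed)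
      then obtain g s where gs: "g \<in> F" "s \<in> S" "inv\<^bsub>H\<^esub> y = g \<otimes>\<^bsub>H\<^esub> s"
        by (auto simp: l_coset_def)
      have "y = inv\<^bsub>H\<^esub> (g \<otimes>\<^bsub>H\<^esub> s)"
        using y gs(3) by (metis inv_inv)
      also have "\<dots> = inv\<^bsub>H\<^esub> s \<otimes>\<^bsub>H\<^esub> inv\<^bsub>H\<^esub> g"
        using gs F(2) S by (intro inv_mult_group) auto
      finally show "y \<in> (\<Union>g\<in>m_inv H ` F. T #>\<^bsub>H\<^esub> g)"
        using T(2)[OF gs(2)] gs(1) by (auto simp: r_coset_def)
    qed
  qed
  moreover have "finite (m_inv H ` F)" "m_inv H ` F \<subseteq> carrier H"
    using F(1,2) by auto
  ultimately show ?thesis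
    using T(1) unfolding right_syndetic_def by (intro conjI exI[of _ "m_inv H ` F"])
qed

section \<open>Means that realise an upper density\<close>

lemma sum_of_bool_mem:
  "finite B \<Longrightarrow> sum (\<lambda>x. of_bool (x \<in> A) :: real) B = card (A \<inter> B)"
  by (simp add: of_bool_def sum.If_cases Int_commute)

lemma upper_density_less_imp_eventually:
  assumes "\<And>N. finite (\<Psi> N)" "upper_density \<Psi> A < L"
  shows "eventually (\<lambda>N. real (card (A \<inter> \<Psi> N)) / real (card (\<Psi> N)) < L) sequentially"
proof -
  have "limsup (\<lambda>N. ereal (real (card (A \<inter> \<Psi> N)) / real (card (\<Psi> N)))) < ereal L"
    using assms ereal_upper_density[of \<Psi> A, symmetric] by simp
  from Limsup_lessD[OF this] show ?thesis by simp
qed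

lemma upper_density_greater_imp_frequently:
  assumes "\<And>N. finite (\<Psi> N)" "L < upper_density \<Psi> A"
  shows "\<exists>N\<ge>k. L < real (card (A \<inter> \<Psi> N)) / real (card (\<Psi> N))"
proof (rule ccontr)
  assume "\<not> ?thesis"
  then have "eventually (\<lambda>N. ereal (real (card (A \<inter> \<Psi> N)) / real (card (\<Psi> N))) \<le> ereal L) sequentially"
    by (auto simp: eventually_sequentially not_less)
  then have "ereal (upper_density \<Psi> A) \<le> ereal L"
    unfolding ereal_upper_density[OF assms(1)] by (rule Limsup_bounded)
  with assms(2) show False by simp
qed

lemma exists_density_mean:
  assumes H: "group H" and \<Psi>: "left_Folner_seq H \<Psi>"
  shows "\<exists>\<mu>. left_mean H \<mu> \<and> upper_density \<Psi> E \<le> \<mu> (\<lambda>x. of_bool (x \<in> E)) \<and>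
    (\<forall>A. \<mu> (\<lambda>x. of_bool (x \<in> A)) \<le> upper_density \<Psi> A)"
proof -
  have fin: "finite (\<Psi> N)" and ne: "\<Psi> N \<noteq> {}" for N
    using \<Psi> by (auto simp: left_Folner_seq_def)
  \<comment> \<open>The condition \<open>k \<le> N\<close> makes the chosen indices tend to
    infinity, which is all that a Folner sequence needs along them.\<close>
  have "\<exists>N\<ge>k. upper_density \<Psi> E - 1 / Suc k < real (card (E \<inter> \<Psi> N)) / real (card (\<Psi> N))" for k
    by (rule upper_density_greater_imp_frequently) (auto simp: fin)
  then obtain r where r: "\<And>k. k \<le> r k"
    "\<And>k. upper_density \<Psi> E - 1 / Suc k < real (card (E \<inter> \<Psi> (r k))) / real (card (\<Psi> (r k)))"
    by metis
  have lim: "filterlim r at_top sequentially"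
    using r(1) by (intro filterlim_at_top_mono[OF filterlim_ident]) auto
  obtain \<mu> where \<mu>: "left_mean H \<mu>" and
    le: "\<And>f L. bdd f \<Longrightarrow> eventually (\<lambda>k. sum f (\<Psi> (r k)) / card (\<Psi> (r k)) \<le> L) sequentially \<Longrightarrow> \<mu> f \<le> L"
    using exists_Folner_mean[OF H left_Folner_seq_subseq[OF \<Psi> lim]] by blast
  interpret \<mu>: left_mean H \<mu> by (rule \<mu>)
  have "\<mu> (\<lambda>x. of_bool (x \<in> A)) \<le> upper_density \<Psi> A" for A
  proof (rule field_le_epsilon)
    fix e :: real assume "e > 0"
    then have "eventually (\<lambda>N. real (card (A \<inter> \<Psi> N)) / real (card (\<Psi> N)) < upper_density \<Psi> A + e) sequentially"
      by (intro upper_density_less_imp_eventually fin) simp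
    from eventually_compose_filterlim[OF this lim]
    show "\<mu> (\<lambda>x. of_bool (x \<in> A)) \<le> upper_density \<Psi> A + e"
      by (intro le bdd_of_bool) (auto simp: sum_of_bool_mem[OF fin] elim: eventually_mono)
  qed
  moreover have "upper_density \<Psi> E \<le> \<mu> (\<lambda>x. of_bool (x \<in> E))"
  proof (rule field_le_epsilon)
    fix e :: real assume "e > 0"
    then obtain k0 where k0: "1 / real (Suc k0) < e"
      using nat_approx_posE by metis
    \<comment> \<open>Only upper bounds on averages pass to \<open>\<mu>\<close>, so the lower bound
      for \<open>E\<close> is obtained from the negated indicator.\<close>
    have "sum (\<lambda>x. (-1) * of_bool (x \<in> E)) (\<Psi> (r k)) / card (\<Psi> (r k)) \<le> e - upper_density \<Psi> E"
      if "k \<ge> k0" for k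
    proof -
      have "1 / real (Suc k) \<le> 1 / real (Suc k0)"
        using that by (intro divide_left_mono) auto
      then have "upper_density \<Psi> E - e \<le> real (card (E \<inter> \<Psi> (r k))) / real (card (\<Psi> (r k)))"
        using r(2)[of k] k0 by linarith
      then show ?thesis
        by (simp only: sum_distrib_left[symmetric] sum_of_bool_mem[OF fin])
    qed
    then have "\<mu> (\<lambda>x. (-1) * of_bool (x \<in> E)) \<le> e - upper_density \<Psi> E"
      by (intro le bdd_mult bdd_const bdd_of_bool) (auto simp: eventually_sequentially)
    then show "upper_density \<Psi> E \<le> \<mu> (\<lambda>x. of_bool (x \<in> E)) + e"
      by (simp only: \<mu>.scale[OF bdd_of_bool])
  qed
  ultimately show ?thesis
    using \<mu> by blast
qed

section \<open>From the power group to coordinates and corners\<close>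

lemma carrier_power_group: "carrier (power_group G d) = {1..d} \<rightarrow>\<^sub>E carrier G"
  by (simp add: power_group_def)

context group
begin

lemma group_power_group: "group (power_group G d)"
  by (simp add: power_group_def is_group)

lemma coordinate_mean_if_left_mean:
  assumes "left_mean (power_group G d) \<mu>"
  shows "coordinate_mean G d \<mu>"
proof -
  interpret \<mu>: left_mean "power_group G d" \<mu> by (rule assms)
  have "mean ({1..d} \<rightarrow>\<^sub>E carrier G) \<mu>"
    using \<mu>.mean_axioms by (simp add: carrier_power_group)
  then interpret m: mean "{1..d} \<rightarrow>\<^sub>E carrier G" \<mu> .
  show ?thesis
  proof
    fix f :: "(nat \<Rightarrow> 'a) \<Rightarrow> real" and i a
    assume f: "bdd f" and i: "i \<in> {1..d}" and a: "a \<in> carrier G"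
    \<comment> \<open>Translating coordinate \<open>i\<close> by \<open>a\<close> is left
      multiplication by this element, which is trivial in every other coordinate.\<close>
    define e where "e = (\<lambda>j\<in>{1..d}. if j = i then a else \<one>)"
    have e: "e \<in> carrier (power_group G d)"
      using a by (auto simp: e_def carrier_power_group)
    have "e \<otimes>\<^bsub>power_group G d\<^esub> h = h(i := a \<otimes> h i)" if h: "h \<in> {1..d} \<rightarrow>\<^sub>E carrier G" for h
    proof
      fix j
      show "(e \<otimes>\<^bsub>power_group G d\<^esub> h) j = (h(i := a \<otimes> h i)) j"
        using h i by (cases "j \<in> {1..d}") (auto simp: power_group_def e_def PiE_iff extensional_def)
    qed
    then have "\<mu> (\<lambda>h. f (h(i := a \<otimes> h i))) = \<mu> (\<lambda>h. f (e \<otimes>\<^bsub>power_group G d\<^esub> h))"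
      by (intro m.cong bdd_comp[OF f]) simp
    then show "\<mu> (\<lambda>h. f (h(i := a \<otimes> h i))) = \<mu> f"
      using \<mu>.translate[OF f e] by simp
  qed
qed

text \<open>The cube of \<open>inv h\<close> based at \<open>inv h \<otimes> g\<close> has the same
  vertices as the cube of \<open>h\<close> based at \<open>g\<close>, with \<open>J\<close> and its
  complement interchanged; left invariance absorbs the change of base point.\<close>

lemma corner_mean_inv:
  assumes "left_mean (power_group G d) \<mu>" and h: "h \<in> carrier (power_group G d)"
  shows "coordinate_mean.corner_mean G \<mu> E {1..d} (inv\<^bsub>power_group G d\<^esub> h) =
    coordinate_mean.corner_mean G \<mu> E {1..d} h"
proof -
  interpret \<mu>: left_mean "power_group G d" \<mu> by (rule assms(1))
  interpret c: coordinate_mean G d \<mu> by (rule coordinate_mean_if_left_mean[OF assms(1)])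
  let ?h' = "inv\<^bsub>power_group G d\<^esub> h"
  have h': "?h' \<in> carrier (power_group G d)"
    using h by simp
  have hX: "h \<in> {1..d} \<rightarrow>\<^sub>E carrier G"
    using h by (simp add: carrier_power_group)
  then have inv_h: "?h' = (\<lambda>i\<in>{1..d}. inv (h i))"
    unfolding power_group_def by (intro inv_product_group) (auto intro: is_group)
  let ?f = "\<lambda>g. of_bool (\<forall>J\<subseteq>{1..d}. shift J ?h' g \<in> E) :: real"
  have "shift J ?h' (?h' \<otimes>\<^bsub>power_group G d\<^esub> g) = shift ({1..d} - J) h g"
    if J: "J \<subseteq> {1..d}" and g: "g \<in> {1..d} \<rightarrow>\<^sub>E carrier G" for J g
  proof
    fix i
    show "shift J ?h' (?h' \<otimes>\<^bsub>power_group G d\<^esub> g) i = shift ({1..d} - J) h g i"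
    proof (cases "i \<in> {1..d}")
      case True
      then have "h i \<in> carrier G" "g i \<in> carrier G"
        using hX g by auto
      with True show ?thesis
        unfolding inv_h by (simp add: power_group_def shift_def m_assoc[symmetric])
    next
      case False
      with J g show ?thesis
        unfolding inv_h by (auto simp: power_group_def shift_def PiE_iff extensional_def)
    qed
  qed
  then have eq: "(\<forall>J\<subseteq>{1..d}. shift J ?h' (?h' \<otimes>\<^bsub>power_group G d\<^esub> g) \<in> E) \<longleftrightarrow>
      (\<forall>J\<subseteq>{1..d}. shift J h g \<in> E)" if "g \<in> {1..d} \<rightarrow>\<^sub>E carrier G" for g
    using that by (metis Diff_subset double_diff order_refl)
  have "bdd ?f"
    by (rule bdd_of_bool)
  then have "\<mu> ?f = \<mu> (\<lambda>g. ?f (?h' \<otimes>\<^bsub>power_group G d\<^esub> g))"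
    using h' by (rule \<mu>.translate[symmetric])
  also have "\<dots> = \<mu> (\<lambda>g. of_bool (\<forall>J\<subseteq>{1..d}. shift J h g \<in> E))"
    by (intro c.cong bdd_of_bool) (simp only: eq)
  finally show ?thesis
    unfolding c.corner_mean_def .
qed

lemma cube_subset_iff:
  assumes h: "h \<in> {1..d} \<rightarrow>\<^sub>E carrier G" and g: "g \<in> {1..d} \<rightarrow>\<^sub>E carrier G"
  shows "cube G d h g \<subseteq> E \<longleftrightarrow> (\<forall>J\<subseteq>{1..d}. shift J h g \<in> E)"
proof -
  have shift_eq: "shift {i \<in> {1..d}. \<epsilon> i = 1} h g = (\<lambda>i\<in>{1..d}. (h i [^] (- \<epsilon> i)) \<otimes> g i)"
    if "\<epsilon> \<in> {1..d} \<rightarrow>\<^sub>E {0, 1}" for \<epsilon> :: "nat \<Rightarrow> int"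
  proof
    fix i
    show "shift {i \<in> {1..d}. \<epsilon> i = 1} h g i = (\<lambda>i\<in>{1..d}. (h i [^] (- \<epsilon> i)) \<otimes> g i) i"
    proof (cases "i \<in> {1..d}")
      case True
      then have "h i \<in> carrier G" "g i \<in> carrier G" "\<epsilon> i = 0 \<or> \<epsilon> i = 1"
        using h g that by auto
      with True show ?thesis
        by (auto simp: shift_def int_pow_neg)
    next
      case False
      with g show ?thesis
        by (auto simp: shift_def PiE_iff extensional_def)
    qed
  qed
  have "cube G d h g = (\<lambda>J. shift J h g) ` Pow {1..d}"
  proof (intro equalityI subsetI)
    fix x assume "x \<in> cube G d h g"
    then obtain \<epsilon> :: "nat \<Rightarrow> int" where "\<epsilon> \<in> {1..d} \<rightarrow>\<^sub>E {0, 1}"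
      "x = (\<lambda>i\<in>{1..d}. (h i [^] (- \<epsilon> i)) \<otimes> g i)"
      unfolding cube_def by blast
    then have "x = shift {i \<in> {1..d}. \<epsilon> i = 1} h g"
      by (simp only: shift_eq)
    then show "x \<in> (\<lambda>J. shift J h g) ` Pow {1..d}"
      by blast
  next
    fix x assume "x \<in> (\<lambda>J. shift J h g) ` Pow {1..d}"
    then obtain J where J: "J \<subseteq> {1..d}" "x = shift J h g"
      by blast
    define \<epsilon> :: "nat \<Rightarrow> int" where "\<epsilon> = (\<lambda>i\<in>{1..d}. if i \<in> J then 1 else 0)"
    have \<epsilon>: "\<epsilon> \<in> {1..d} \<rightarrow>\<^sub>E {0, 1}"
      by (auto simp: \<epsilon>_def)
    have "{i \<in> {1..d}. \<epsilon> i = 1} = J"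
      using J(1) by (auto simp: \<epsilon>_def)
    with shift_eq[OF \<epsilon>] J(2) have "x = (\<lambda>i\<in>{1..d}. (h i [^] (- \<epsilon> i)) \<otimes> g i)"
      by simp
    with \<epsilon> show "x \<in> cube G d h g"
      unfolding cube_def by blast
  qed
  then show ?thesis by auto
qed

end

theorem corollary1p8:
  fixes G :: "('a, 'm) monoid_scheme"
    and d :: nat
    and E :: "(nat \<Rightarrow> 'a) set"
    and \<Psi> :: "nat \<Rightarrow> (nat \<Rightarrow> 'a) set"
    and c :: real
  assumes "group G"
    and "countable (carrier G)"
    and "amenable G"
    and "E \<subseteq> carrier (power_group G d)"
    and "left_Folner_seq (power_group G d) \<Psi>"
    and "upper_density \<Psi> E > 0"
    and "c > 0"
  defines "R \<equiv> {h \<in> carrier (power_group G d).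
      upper_density \<Psi> {g \<in> carrier (power_group G d). cube G d h g \<subseteq> E}
        > upper_density \<Psi> E ^ (2 ^ d) - c}"
  shows "left_syndetic (power_group G d) R \<and> right_syndetic (power_group G d) R"
proof -
  let ?H = "power_group G d"
  interpret group G by (rule assms(1))
  have H: "group ?H"
    by (rule group_power_group)
  \<comment> \<open>Amenability of \<open>G\<close> supplies the mean \<open>M\<close> used in each
    single coordinate.\<close>
  obtain \<Phi> where "left_Folner_seq G \<Phi>"
    using assms(3) by (auto simp: amenable_def)
  then obtain M where "left_mean G M"
    using exists_Folner_mean[OF assms(1)] by blast
  then interpret left_mean G M .
  interpret iterated_mean G M d ..
  obtain \<mu> where \<mu>: "left_mean ?H \<mu>"
    and ge: "upper_density \<Psi> E \<le> \<mu> (\<lambda>x. of_bool (x \<in> E))"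
    and le: "\<And>A. \<mu> (\<lambda>x. of_bool (x \<in> A)) \<le> upper_density \<Psi> A"
    using exists_density_mean[OF H assms(5)] by blast
  interpret \<mu>: coordinate_mean G d \<mu>
    by (rule coordinate_mean_if_left_mean[OF \<mu>])
  define D where "D = upper_density \<Psi> E ^ 2 ^ d - c"
  \<comment> \<open>The analogue of \<open>R\<close> with \<open>\<mu>\<close> in place of the upper
    density. Since \<open>\<mu>\<close> is dominated by the upper density, \<open>S\<close> lies in
    \<open>R\<close>; unlike densities, \<open>\<mu>\<close> is additive.\<close>
  define S where "S = {h \<in> carrier ?H. D < \<mu>.corner_mean E {1..d} h}"
  have S: "S \<subseteq> carrier ?H"
    by (auto simp: S_def)
  have SR: "S \<subseteq> R"
  proof
    fix h assume h: "h \<in> S"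
    then have hH: "h \<in> carrier ?H"
      by (simp add: S_def)
    have "\<mu>.corner_mean E {1..d} h = \<mu> (\<lambda>g. of_bool (g \<in> {g \<in> carrier ?H. cube G d h g \<subseteq> E}))"
      unfolding \<mu>.corner_mean_def using hH
      by (intro \<mu>.cong bdd_of_bool) (simp add: carrier_power_group cube_subset_iff)
    also have "\<dots> \<le> upper_density \<Psi> {g \<in> carrier ?H. cube G d h g \<subseteq> E}"
      by (rule le)
    finally show "h \<in> R"
      using h by (simp add: R_def S_def D_def)
  qed
  have RH: "R \<subseteq> carrier ?H"
    by (auto simp: R_def)
  have "left_syndetic ?H S"
  proof (rule left_syndeticI_mean[OF H assms(5) S])
    fix m assume m: "left_mean ?H m"
    interpret m: coordinate_mean G d m
      by (rule coordinate_mean_if_left_mean[OF m])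
    define s where "s = m (\<lambda>x. of_bool (x \<in> S))"
    have "upper_density \<Psi> E ^ 2 ^ d \<le> \<mu> (\<lambda>x. of_bool (x \<in> E)) ^ 2 ^ d"
      using ge assms(6) by (intro power_mono) auto
    also have "\<dots> \<le> m (\<mu>.corner_mean E {1..d})"
      by (rule mean_corner_mean_ge[OF \<mu>.coordinate_mean_axioms m.coordinate_mean_axioms])
    \<comment> \<open>Off \<open>S\<close> the corner mean is at most \<open>D\<close>, and on
      \<open>S\<close> it is at most 1, which \<open>D + (1 + \<bar>D\<bar>)\<close> exceeds or
      equals for either sign of \<open>D\<close>. As the left-hand side is at least
      \<open>D + c\<close>, the set \<open>S\<close> has positive mean.\<close>
    also have "\<dots> \<le> m (\<lambda>h. D + (1 + \<bar>D\<bar>) * of_bool (h \<in> S))"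
    proof (rule m.mono)
      fix h assume h: "h \<in> {1..d} \<rightarrow>\<^sub>E carrier G"
      have "\<bar>\<mu>.corner_mean E {1..d} h\<bar> \<le> 1"
        unfolding \<mu>.corner_mean_def by (rule \<mu>.abs_le) simp
      then show "\<mu>.corner_mean E {1..d} h \<le> D + (1 + \<bar>D\<bar>) * of_bool (h \<in> S)"
        using h by (auto simp: S_def carrier_power_group of_bool_def)
    qed (intro \<mu>.bdd_corner_mean bdd_add bdd_mult bdd_const bdd_of_bool)+
    also have "\<dots> = D + (1 + \<bar>D\<bar>) * s"
      unfolding s_def by (simp add: m.add m.scale bdd_mult bdd_of_bool)
    finally have "0 < (1 + \<bar>D\<bar>) * s"
      using assms(7) by (simp add: D_def)
    then show "0 < m (\<lambda>x. of_bool (x \<in> S))"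
      unfolding s_def[symmetric] by (rule zero_less_mult_pos) simp
  qed
  \<comment> \<open>The symmetry of the corner mean makes \<open>S\<close> closed under inversion,
    which turns left-syndeticity of \<open>S\<close> into right-syndeticity of
    \<open>R\<close>.\<close>
  moreover have "inv\<^bsub>?H\<^esub> h \<in> R" if "h \<in> S" for h
  proof -
    have "inv\<^bsub>?H\<^esub> h \<in> S"
      using that corner_mean_inv[OF \<mu>] group.inv_closed[OF H] by (simp add: S_def)
    with SR show ?thesis by blast
  qed
  ultimately show ?thesis
    using left_syndetic_mono[OF H _ SR RH] right_syndetic_inverse[OF H _ RH] by blast
qed

end
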